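(* For every $m\ge0$, $$w_m=-\frac{[Z^{-(2m+2)}]\,\mathsf F}{4\,(2m+1)!},$$ and consequently $\nu_2(w_m)=-2\,\nu_2\bigl((2m)!\bigr)$; that is, $\bigl((2m)!\bigr)^2w_m\in\mathbb Z_2^\times$ for every $m\ge0$.
   Context: Definition of $w_m$. For $\nu$ and $k\ge0$ let $a_k(\nu)=\dfrac{\prod_{j=0}^{k-1}(4\nu^2-(2j+1)^2)}{8^k k!}$. Let $p=1+i$, $q=1-i$, $A=\alpha^2$, $B=\beta^2$, $G_n=\sum_{l=0}^n a_l(\alpha)a_{n-l}(\beta)p^lq^{n-l}$ and $F(Z)=\sum_{n\ge0}\dfrac{G_n}{(Z-1)\cdots(Z-n)}$, a formal power series in $Z^{-1}$ (each summand expanded at $Z=\infty$) with constant term $1$. Write $\log F=\sum_{n\ge1}L_nZ^{-n}$ (each $L_n$ a polynomial in $A,B$ over $\mathbb Q(i)$), $g_n=\partial_AL_n|_{A=B=0}$, $\Phi(t)=\sum_{n\ge1}g_n\dfrac{t^n}{(n-1)!}$. Define the formal series $W(t)$ with rational coefficients by $\dfrac{\sinh(2t)\,\Phi(t)}{t^2}=e^t+iW(t)$; $W$ is even, and $w_m=[t^{2m}]W(t)$. Definition of $\mathsf F$. Let $B_{2j}$ be the Bernoulli numbers, $\mathsf G_{2j}=2(1-2^{2j})B_{2j}$ (Genocchi numbers), $b_j=\dfrac{2^{2j-1}\mathsf G_{2j}}{(2j)(2j-1)}$, and $\mathsf B(Z)=\sum_{j\ge1}b_j(Z-1)^{1-2j}$.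 Then $$\mathsf F(Z)=-\frac{4Z\,e^{\mathsf B(Z)}}{(Z-1)^2(Z+1)},$$ expanded as a formal power series in $Z^{-1}$. $\nu_2$ is the $2$-adic valuation on $\mathbb Q$ and $\mathbb Z_2^\times$ the group of $2$-adic units. *)

theory Defs
  imports "HOL-Analysis.Analysis" "HOL-Computational_Algebra.Computational_Algebra"
begin

section \<open>The numbers \<open>w\<^sub>m\<close>\<close>

text \<open>
  The coefficient \<open>a\<^sub>k(\<nu>)\<close> depends on \<open>\<nu>\<close> only through \<open>\<nu>\<^sup>2\<close>. The argument \<open>N\<close> below is
  \<open>\<nu>\<^sup>2\<close>, so that all quantities built from it are polynomial functions of
  \<open>A = \<alpha>\<^sup>2\<close> and \<open>B = \<beta>\<^sup>2\<close>.
\<close>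

definition a_coeff :: "nat \<Rightarrow> complex \<Rightarrow> complex" where
  "a_coeff k N = (\<Prod>j<k. 4 * N - of_nat ((2 * j + 1)\<^sup>2)) / (8 ^ k * fact k)"

definition G :: "nat \<Rightarrow> complex \<Rightarrow> complex \<Rightarrow> complex" where
  "G n A B = (\<Sum>l\<le>n. a_coeff l A * a_coeff (n - l) B * (1 + \<i>) ^ l * (1 - \<i>) ^ (n - l))"

text \<open>
  In this theory, a formal power series in \<open>Z\<^sup>-\<^sup>1\<close> is an \<^typ>\<open>'a fps\<close> whose variable \<^const>\<open>fps_X\<close>
  stands for \<open>Z\<^sup>-\<^sup>1\<close>; for instance \<open>(Z - j)\<^sup>-\<^sup>1 = Z\<^sup>-\<^sup>1 / (1 - j Z\<^sup>-\<^sup>1)\<close>.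
\<close>

definition inv_falling :: "nat \<Rightarrow> complex fps" where
  "inv_falling n = (\<Prod>j=1..n. fps_X * inverse (1 - of_nat j * fps_X))"

text \<open>
  \<^term>\<open>inv_falling n\<close> begins in degree \<open>n\<close>, so only the summands with index \<open>n \<le> k\<close>
  contribute to the coefficient of \<open>Z\<^sup>-\<^sup>k\<close>.
\<close>

definition F :: "complex \<Rightarrow> complex \<Rightarrow> complex fps" where
  "F A B = Abs_fps (\<lambda>k. \<Sum>n\<le>k. G n A B * fps_nth (inv_falling n) k)"

text \<open>\<^term>\<open>fps_ln 1\<close> is the series of \<open>log (1 + X)\<close>.\<close>

definition L :: "nat \<Rightarrow> complex \<Rightarrow> complex \<Rightarrow> complex" where
  "L n A B = fps_nth (fps_ln 1 oo (F A B - 1)) n"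

definition g :: "nat \<Rightarrow> complex" where
  "g n = deriv (\<lambda>A. L n A 0) 0"

definition Phi :: "complex fps" where
  "Phi = Abs_fps (\<lambda>n. if n = 0 then 0 else g n / fact (n - 1))"

definition sinh_2t :: "complex fps" where
  "sinh_2t = fps_const (1 / 2) * (fps_exp 2 - fps_exp (- 2))"

text \<open>
  The solution of \<open>sinh(2t) \<Phi>(t) / t\<^sup>2 = e\<^sup>t + i W(t)\<close>. Both factors of the numerator have zero
  constant term, so the division by \<open>t\<^sup>2\<close> is exact.
\<close>

definition W :: "complex fps" where
  "W = fps_const (- \<i>) * (sinh_2t * Phi / fps_X\<^sup>2 - fps_exp 1)"

text \<open>
  The coefficients of \<^const>\<open>W\<close> are rational, but \<^const>\<open>W\<close> has complex coefficients as a
  formal object; \<open>w m\<close> is the rational number equal to the coefficient of \<open>t\<^sup>2\<^sup>m\<close>.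
\<close>

definition w :: "nat \<Rightarrow> rat" where
  "w m = (THE r. of_rat r = fps_nth W (2 * m))"


section \<open>The series \<open>\<F>\<close>\<close>

text \<open>Bernoulli numbers, with generating function \<open>x / (e\<^sup>x - 1) = \<Sum> B\<^sub>n x\<^sup>n / n!\<close>.\<close>

definition bernoulli :: "nat \<Rightarrow> rat" where
  "bernoulli n = fact n * fps_nth (fps_X / (fps_exp 1 - 1)) n"

text \<open>\<open>genocchi_even j\<close> and \<open>b j\<close> are the Genocchi number of index \<open>2j\<close> and \<open>b\<^sub>j\<close>.\<close>

definition genocchi_even :: "nat \<Rightarrow> rat" where
  "genocchi_even j = 2 * (1 - 2 ^ (2 * j)) * bernoulli (2 * j)"

definition b :: "nat \<Rightarrow> rat" where
  "b j = 2 ^ (2 * j - 1) * genocchi_even j / (of_nat (2 * j) * of_nat (2 * j - 1))"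

text \<open>
  \<open>\<Sum>\<^sub>j\<^sub>\<ge>\<^sub>1 b\<^sub>j Y\<^sup>2\<^sup>j\<^sup>-\<^sup>1\<close> at \<open>Y = (Z - 1)\<^sup>-\<^sup>1 = Z\<^sup>-\<^sup>1 / (1 - Z\<^sup>-\<^sup>1)\<close>; an odd exponent \<open>k = 2j - 1\<close> has
  \<open>j = (k + 1) / 2\<close>.
\<close>

definition B_series :: "rat fps" where
  "B_series =
     Abs_fps (\<lambda>k. if odd k then b ((k + 1) div 2) else 0) oo (fps_X * inverse (1 - fps_X))"

text \<open>
  \<open>Z / ((Z - 1)\<^sup>2 (Z + 1)) = Z\<^sup>-\<^sup>2 / ((1 - Z\<^sup>-\<^sup>1)\<^sup>2 (1 + Z\<^sup>-\<^sup>1))\<close>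
\<close>

definition FF :: "rat fps" where
  "FF = - 4 * fps_X\<^sup>2 * (fps_exp 1 oo B_series) * inverse ((1 - fps_X)\<^sup>2 * (1 + fps_X))"


section \<open>The 2-adic valuation on the rationals\<close>

text \<open>Only meaningful at nonzero arguments: the value at \<open>0\<close> is \<open>0\<close> instead of \<open>\<infinity>\<close>.\<close>

definition nu2 :: "rat \<Rightarrow> int" where
  "nu2 r = int (multiplicity 2 (fst (quotient_of r))) - int (multiplicity 2 (snd (quotient_of r)))"

text \<open>The rational numbers that are 2-adic units.\<close>

definition two_adic_units :: "rat set" where
  "two_adic_units = {r. r \<noteq> 0 \<and> nu2 r = 0}"

end

theory Submission
  imports Defs
begin

text \<open>
  The numbers \<open>a\<^sub>k(\<nu>)\<close> are the coefficients of the expansion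
  \<open>K\<^sub>\<nu>(z) \<sim> sqrt(\<pi> / (2 z)) e\<^sup>-\<^sup>z \<Sum> a\<^sub>k(\<nu>) z\<^sup>-\<^sup>k\<close> of the modified Bessel function. With \<open>p = 1 + \<i>\<close> and
  \<open>q = 1 - \<i>\<close> one has \<open>1/p + 1/q = 1\<close>, so \<open>e\<^sup>-\<^sup>z z\<^sup>-\<^sup>1 \<Sum> G\<^sub>n z\<^sup>-\<^sup>n\<close> is, up to a constant, the expansion
  of the product \<open>y(z) = K\<^sub>\<alpha>(z/p) K\<^sub>\<beta>(z/q)\<close>. Since
  \<open>\<integral> e\<^sup>-\<^sup>z z\<^sup>Z\<^sup>-\<^sup>1 z\<^sup>-\<^sup>n dz = \<Gamma>(Z) / ((Z-1)\<cdots>(Z-n))\<close>, the series \<open>F\<close> is, up to the same constant, the Mellin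
  transform of \<open>z y(z)\<close> divided by \<open>\<Gamma>(Z)\<close>. Under this transform the differential equation of \<open>y\<close> becomes a difference
  equation of \<open>F\<close>. The integrals serve as motivation only: the termwise
  transform \<open>mellin\<close> of formal series has the same two rules \<open>mellin_X_mult\<close> and \<open>mellin_X_X_deriv\<close>.

  Let \<open>D = z d/dz\<close>. The factors of \<open>y\<close> satisfy \<open>D\<^sup>2 u = (z\<^sup>2/p\<^sup>2 + A) u\<close> and
  \<open>D\<^sup>2 v = (z\<^sup>2/q\<^sup>2 + B) v\<close>, and \<open>1/p\<^sup>2 + 1/q\<^sup>2 = 0\<close>. This coincidence makes the equation of \<open>y\<close> at
  \<open>A = B = 0\<close> collapse to \<open>(D - 2) D\<^sup>3 y = z\<^sup>4 y\<close>, and hence \<open>F\<^sub>0 = F(0,0)\<close> has a two-term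
  recurrence, \<open>F\<^sub>0(Z) / F\<^sub>0(Z-4) = (Z-3)\<^sup>2 / ((Z-2)(Z-4))\<close>. Differentiating in \<open>A\<close> gives the same
  recurrence with source terms; dividing it by the one for \<open>F\<^sub>0\<close> leaves an equation between \<open>R(Z)\<close> and \<open>R(Z-4)\<close> for
  \<open>R = \<Sum> g\<^sub>n Z\<^sup>-\<^sup>n = \<partial>\<^sub>A F / F\<close> at the origin, after a shift
  \<open>R(Z-2) - R(Z+2) = 2/(Z-1)\<^sup>2 + 2 \<i> F\<^sub>0(Z) / ((Z\<^sup>2-1) F\<^sub>0(Z+2))\<close> (lemma \<open>g_difference_equation\<close>).

  The formal Laplace transform \<open>t\<^sup>n \<mapsto> n! Z\<^sup>-\<^sup>n\<^sup>-\<^sup>1\<close> sends \<open>\<Phi>(t)/t\<close> to \<open>R\<close> and turns multiplication by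
  \<open>e\<^sup>-\<^sup>a\<^sup>t\<close> into the shift by \<open>a\<close>. Thus the left-hand side above is the transform of
  \<open>2 sinh(2t) \<Phi>(t)/t\<close>, and \<open>2/(Z-1)\<^sup>2\<close> is the transform of \<open>2 t e\<^sup>t\<close>. What remains says that
  \<open>t W(t)\<close> has transform \<open>F\<^sub>0(Z) / ((Z\<^sup>2-1) F\<^sub>0(Z+2))\<close> (lemma \<open>W_nth\<close>).

  To identify this with \<open>-\<F>/4\<close>, put \<open>Q(Z) = (1 - 1/Z) F\<^sub>0(Z) / F\<^sub>0(Z+2)\<close>. The recurrence of \<open>F\<^sub>0\<close>
  gives \<open>Q(Z+2) Q(Z) = (Z-1)/(Z+1)\<close>, which determines a series with constant term \<open>1\<close>. The series
  \<open>e\<^sup>\<B>\<close> satisfies the same equation, because \<open>\<B>\<close> is, in the variable \<open>Z - 1\<close>, the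
  Laplace transform of \<open>-tanh(t)/t\<close> and \<open>(1 + e\<^sup>-\<^sup>2\<^sup>t) tanh t = 1 - e\<^sup>-\<^sup>2\<^sup>t\<close>.

  For the valuation, let \<open>e\<^sub>n\<close> be the coefficients of \<open>exp (\<Sum> b\<^sub>j Y\<^sup>2\<^sup>j\<^sup>-\<^sup>1)\<close>. The derivative of the
  exponent has the coefficients \<open>-T\<^sub>n\<^sub>+\<^sub>1\<close>, where \<open>T\<^sub>n = n! [t\<^sup>n] tanh t\<close> are integers, even except for
  \<open>T\<^sub>1 = 1\<close>. The differential equation of the exponential then shows that all \<open>n! e\<^sub>n\<close> are odd
  integers. Substituting \<open>Y = 1/(Z-1)\<close> and multiplying by \<open>Z / ((Z-1)\<^sup>2(Z+1))\<close> expresses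
  \<open>-[Z\<^sup>-\<^sup>2\<^sup>m\<^sup>-\<^sup>2] \<F> / 4\<close> as an integral combination of \<open>e\<^sub>0, \<dots>, e\<^sub>2\<^sub>m\<close> in which \<open>e\<^sub>2\<^sub>m\<close> has
  coefficient \<open>1\<close>. After multiplication by \<open>(2m)!\<close> the other terms become even, as
  \<open>(2m)!/n!\<close> is a multiple of \<open>2m\<close> for \<open>n < 2m\<close>. So \<open>(2m)! (2m+1)! w\<^sub>m\<close> is an odd integer.
\<close>

section \<open>Shifts of formal power series at infinity\<close>

text \<open>
  With \<open>X = Z\<^sup>-\<^sup>1\<close> this is \<open>(Z - c) / Z\<close>, the form in which the linear factors of all difference
  equations below occur.
\<close>

definition lin :: "'a::field_char_0 \<Rightarrow> 'a fps" where
  "lin c = 1 - fps_const c * fps_X"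

text \<open>
  The substitution \<open>Z \<mapsto> Z + a\<close>: it sends \<open>X = Z\<^sup>-\<^sup>1\<close> to \<open>1 / (Z + a) = X / (1 + a X)\<close>.
\<close>

definition shift :: "'a::field_char_0 \<Rightarrow> 'a fps \<Rightarrow> 'a fps" where
  "shift a f = f oo (fps_X * inverse (lin (- a)))"

lemma lin_nth_0 [simp]: "fps_nth (lin c) 0 = 1"
  by (simp add: lin_def)

lemma lin_0 [simp]: "lin 0 = 1"
  by (simp add: lin_def)

lemma lin_inverse [simp]: "lin c * inverse (lin c) = 1" "inverse (lin c) * lin c = 1"
  by (simp_all add: inverse_mult_eq_1 inverse_mult_eq_1')

lemma lin_neq_0 [simp]: "lin c \<noteq> 0"
  by (metis lin_nth_0 fps_zero_nth zero_neq_one)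

lemma shift_nth_0 [simp]: "fps_nth (shift a f) 0 = fps_nth f 0"
  by (simp add: shift_def)

lemma shift_add: "shift a (f + h) = shift a f + shift a h"
  and shift_diff: "shift a (f - h) = shift a f - shift a h"
  and shift_mult: "shift a (f * h) = shift a f * shift a h"
  and shift_power: "shift a (f ^ n) = shift a f ^ n"
  and shift_const: "shift a (fps_const c) = fps_const c"
  and shift_1: "shift a 1 = 1"
  by (simp_all add: shift_def fps_compose_add_distrib fps_compose_sub_distrib
      fps_compose_mult_distrib fps_compose_power)

lemma shift_inverse: "fps_nth f 0 \<noteq> 0 \<Longrightarrow> shift a (inverse f) = inverse (shift a f)"
  by (simp add: shift_def fps_inverse_compose)

lemma shift_X: "shift a fps_X = fps_X * inverse (lin (- a))"
  by (simp add: shift_def)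

lemma shift_lin: "shift a (lin c) = lin (c - a) * inverse (lin (- a))"
proof -
  have "shift a (lin c) = lin (- a) * inverse (lin (- a)) - fps_const c * (fps_X * inverse (lin (- a)))"
    by (subst lin_def) (simp add: shift_diff shift_mult shift_const shift_X shift_1)
  also have "\<dots> = (lin (- a) - fps_const c * fps_X) * inverse (lin (- a))"
    by (simp only: algebra_simps)
  also have "lin (- a) - fps_const c * fps_X = lin (c - a)"
    by (simp add: lin_def algebra_simps flip: fps_const_add fps_const_sub)
  finally show ?thesis .
qed

lemma lin_cancel [simp]: "lin c * (inverse (lin c) * f) = f" "inverse (lin c) * (lin c * f) = f"
  by (simp_all flip: mult.assoc)

lemma shift_shift: "shift a (shift c f) = shift (a + c) f"
proof -
  have "shift a (fps_X * inverse (lin (- c))) = fps_X * inverse (lin (- c - a))"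
    by (simp add: shift_mult shift_X shift_inverse shift_lin fps_inverse_mult
        fps_inverse_idempotent mult_ac)
  also have "- c - a = - (a + c)"
    by simp
  finally show ?thesis
    unfolding shift_def by (subst fps_compose_assoc [symmetric]) simp_all
qed

lemma shift_0 [simp]: "shift 0 f = f"
  by (simp add: shift_def)

lemma shift_numeral: "shift a (numeral k) = numeral k"
  by (simp add: shift_def)

lemma fps_mult_right_cancel_rule:
  fixes f h k :: "'a::field_char_0 fps"
  shows "f * h = k * h \<Longrightarrow> h \<noteq> 0 \<Longrightarrow> f = k"
  by simp

lemma fps_X_mult_unit_power_nth:
  fixes f :: "'a::field_char_0 fps"
  assumes "fps_nth f 0 = 1"
  shows "fps_nth ((fps_X * f) ^ n) n = 1"
  using assms by (simp add: power_mult_distrib fps_X_power_mult_nth fps_power_zeroth)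

lemma shift_nth: "fps_nth (shift a f) k
    = (\<Sum>i\<le>k. fps_nth f i * fps_nth ((fps_X * inverse (lin (- a))) ^ i) k)"
  by (simp add: shift_def fps_compose_nth atLeast0AtMost)

text \<open>
  The substituted series is \<open>X + O(X\<^sup>2)\<close>, so a shift does not change the leading term.
\<close>

lemma shift_nth_leading:
  assumes "\<And>j. j < k \<Longrightarrow> fps_nth f j = 0"
  shows "fps_nth (shift a f) k = fps_nth f k"
proof -
  have "fps_nth (shift a f) k = (\<Sum>i\<in>{k}. fps_nth f i * fps_nth ((fps_X * inverse (lin (- a))) ^ i) k)"
    unfolding shift_nth using assms by (intro sum.mono_neutral_right) auto
  then show ?thesis
    by (simp add: fps_X_mult_unit_power_nth)
qed

text \<open>
  If \<open>s X\<^sup>k\<close> were the leading term of \<open>f - 1\<close>, the coefficient of \<open>X\<^sup>k\<close> on the left would be \<open>2 s\<close>,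
  since the shifted factor contributes the same leading term.
\<close>

lemma shift_mult_self_eq_1:
  fixes f :: "'a::field_char_0 fps"
  assumes f0: "fps_nth f 0 = 1" and f: "shift a f * f = 1"
  shows "f = 1"
proof -
  define s where "s = f - 1"
  have fs: "f = 1 + s" and s0: "fps_nth s 0 = 0"
    using f0 by (simp_all add: s_def)
  have eq: "shift a s + s + s * shift a s = 0"
    using f unfolding fs by (simp add: shift_add shift_1 algebra_simps)
  have "fps_nth s k = 0" for k
  proof (induction k rule: less_induct)
    case (less k)
    have "fps_nth (s * shift a s) k = 0"
      unfolding fps_mult_nth
    proof (intro sum.neutral ballI)
      fix i assume "i \<in> {0..k}"
      then have "i < k \<or> i = k"
        by auto
      then show "fps_nth s i * fps_nth (shift a s) (k - i) = 0"
        using less.IH s0 by auto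
    qed
    moreover have "fps_nth (shift a s) k = fps_nth s k"
      using less.IH by (rule shift_nth_leading)
    ultimately show "fps_nth s k = 0"
      using arg_cong [OF eq, of "\<lambda>x. fps_nth x k"] by simp
  qed
  then show ?thesis
    by (simp add: fs fps_eq_iff)
qed

lemma shift_mult_self_unique:
  fixes f h :: "'a::field_char_0 fps"
  assumes "fps_nth f 0 = 1" "fps_nth h 0 = 1" "shift a f * f = shift a h * h"
  shows "f = h"
proof -
  have h: "h * inverse h = 1" "shift a h * inverse (shift a h) = 1"
    by (simp_all add: inverse_mult_eq_1' assms)
  have "shift a (f * inverse h) * (f * inverse h) = (shift a f * f) * (inverse (shift a h) * inverse h)"
    by (simp add: shift_mult shift_inverse assms mult_ac)
  also have "\<dots> = (h * inverse h) * (shift a h * inverse (shift a h))"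
    unfolding assms(3) by (simp only: mult_ac)
  finally have "shift a (f * inverse h) * (f * inverse h) = 1"
    by (simp only: h mult_1_left)
  then have *: "f * inverse h = 1"
    by (rule shift_mult_self_eq_1 [rotated]) (simp add: assms(1,2))
  have "f = f * (h * inverse h)"
    by (simp only: h mult_1_right)
  also have "\<dots> = (f * inverse h) * h"
    by (simp only: mult_ac)
  finally show ?thesis
    by (simp only: * mult_1_left)
qed

section \<open>Formal Laplace transform\<close>

text \<open>
  The formal version of \<open>f \<mapsto> \<integral> e\<^sup>-\<^sup>Z\<^sup>t f(t) dt\<close> over the positive half-line, which sends \<open>t\<^sup>n\<close> to
  \<open>n! Z\<^sup>-\<^sup>n\<^sup>-\<^sup>1\<close>.
\<close>

definition laplace :: "'a::field_char_0 fps \<Rightarrow> 'a fps" where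
  "laplace f = Abs_fps (\<lambda>n. if n = 0 then 0 else fact (n - 1) * fps_nth f (n - 1))"

lemma laplace_nth_0 [simp]: "fps_nth (laplace f) 0 = 0"
  and laplace_nth_Suc [simp]: "fps_nth (laplace f) (Suc n) = fact n * fps_nth f n"
  by (simp_all add: laplace_def)

lemma laplace_add: "laplace (f + h) = laplace f + laplace h"
  and laplace_diff: "laplace (f - h) = laplace f - laplace h"
  and laplace_const_mult: "laplace (fps_const c * f) = fps_const c * laplace f"
  by (simp_all add: laplace_def fps_eq_iff algebra_simps)

text \<open>
  Under the integral the factor \<open>e\<^sup>-\<^sup>a\<^sup>t\<close> replaces \<open>Z\<close> by \<open>Z + a\<close>. Formally this is the expansion of
  \<open>(X / (1 + a X))\<^sup>k\<^sup>+\<^sup>1\<close>, whose binomial coefficients are those of the product with the exponential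
  series.
\<close>

lemma laplace_exp_mult: "laplace (fps_exp (- a) * f) = shift a (laplace f)"
proof (rule fps_ext)
  fix n
  show "fps_nth (laplace (fps_exp (- a) * f)) n = fps_nth (shift a (laplace f)) n"
  proof (cases n)
    case 0
    then show ?thesis by simp
  next
    case (Suc n)
    have pow: "fps_nth ((fps_X * inverse (lin (- a))) ^ Suc k) (Suc n)
        = of_nat (n choose k) * (- a) ^ (n - k)" if "k \<le> n" for k
    proof -
      have "(fps_X * inverse (lin (- a))) ^ Suc k
          = fps_X ^ Suc k * Abs_fps (\<lambda>j. of_nat ((Suc k + j - 1) choose j) * (- a) ^ j)"
        by (simp only: power_mult_distrib fps_inverse_power [symmetric])
           (simp only: lin_def one_minus_const_fps_X_neg_power' [OF zero_less_Suc])
      moreover have "n choose (n - k) = n choose k"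
        using that by (rule binomial_symmetric [symmetric])
      ultimately show ?thesis
        using that by (simp only: fps_X_power_mult_nth fps_nth_Abs_fps) simp
    qed
    have "fps_nth (shift a (laplace f)) (Suc n)
        = (\<Sum>i\<le>Suc n. fps_nth (laplace f) i * fps_nth ((fps_X * inverse (lin (- a))) ^ i) (Suc n))"
      by (simp add: shift_def fps_compose_nth atLeast0AtMost)
    also have "\<dots> = (\<Sum>k\<le>n. fps_nth (laplace f) (Suc k)
          * fps_nth ((fps_X * inverse (lin (- a))) ^ Suc k) (Suc n))"
      by (subst sum.atMost_Suc_shift) simp
    also have "\<dots> = (\<Sum>k\<le>n. fact n * (fps_nth f k * ((- a) ^ (n - k) / fact (n - k))))"
      by (rule sum.cong [OF refl]) (simp add: pow binomial_fact del: power_Suc)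
    also have "\<dots> = fps_nth (laplace (fps_exp (- a) * f)) (Suc n)"
      by (simp add: mult.commute [of "fps_exp (- a)"] fps_mult_nth sum_distrib_left atLeast0AtMost)
    finally show ?thesis
      using Suc by simp
  qed
qed

section \<open>Formal Mellin transform\<close>

text \<open>
  The argument \<open>h\<close> is a series in \<open>x = z\<^sup>-\<^sup>1\<close>, and the value is the formal version of
  \<open>\<integral> e\<^sup>-\<^sup>z z\<^sup>Z\<^sup>-\<^sup>1 h(1/z) dz / \<Gamma>(Z)\<close>.
\<close>

definition mellin :: "complex fps \<Rightarrow> complex fps" where
  "mellin h = Abs_fps (\<lambda>k. \<Sum>n\<le>k. fps_nth h n * fps_nth (inv_falling n) k)"

lemma inv_falling_nth_eq_0: "k < n \<Longrightarrow> fps_nth (inv_falling n) k = 0"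
proof -
  have "inv_falling n = fps_X ^ n * (\<Prod>j=1..n. inverse (1 - of_nat j * fps_X))"
    by (simp add: inv_falling_def prod.distrib)
  then show "k < n \<Longrightarrow> fps_nth (inv_falling n) k = 0"
    by (simp add: fps_X_power_mult_nth)
qed

text \<open>
  A common bound for the number of summands at several coefficients, which allows sums to be
  interchanged.
\<close>

lemma mellin_nth:
  assumes "k \<le> K"
  shows "fps_nth (mellin h) k = (\<Sum>n\<le>K. fps_nth h n * fps_nth (inv_falling n) k)"
proof -
  have "(\<Sum>n\<le>k. fps_nth h n * fps_nth (inv_falling n) k) = (\<Sum>n\<le>K. fps_nth h n * fps_nth (inv_falling n) k)"
    using assms by (intro sum.mono_neutral_left) (auto simp: inv_falling_nth_eq_0)
  then show ?thesis
    by (simp add: mellin_def)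
qed

lemma mellin_add: "mellin (f + h) = mellin f + mellin h"
  by (simp add: mellin_def fps_eq_iff distrib_right sum.distrib)

lemma mellin_const_mult: "mellin (fps_const c * h) = fps_const c * mellin h"
  by (simp add: mellin_def fps_eq_iff sum_distrib_left mult.assoc)

lemma inv_falling_Suc:
  "inv_falling (Suc n) = fps_X * inverse (lin (of_nat (Suc n))) * inv_falling n"
  by (simp add: inv_falling_def lin_def fps_of_nat mult.commute del: of_nat_Suc)

text \<open>
  The product \<open>(Z-1)\<cdots>(Z-n-1)\<close> with its first factor split off instead of its last.
\<close>

lemma inv_falling_Suc_shift: "inv_falling (Suc n) = fps_X * inverse (lin 1) * shift (- 1) (inv_falling n)"
proof (induction n)
  case 0
  then show ?case by (simp add: inv_falling_Suc) (simp add: inv_falling_def shift_1)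
next
  case (Suc n)
  have *: "shift (- 1) (inverse (lin (of_nat (Suc n)))) = lin 1 * inverse (lin (of_nat (Suc (Suc n)) :: complex))"
    by (simp add: shift_inverse shift_lin fps_inverse_mult fps_inverse_idempotent mult_ac add_ac)
  have "fps_X * inverse (lin 1) * shift (- 1) (inv_falling (Suc n))
      = fps_X * inverse (lin (of_nat (Suc (Suc n)))) * (fps_X * inverse (lin 1) * shift (- 1) (inv_falling n))"
    by (subst inv_falling_Suc) (simp add: shift_mult shift_X * mult_ac del: of_nat_Suc)
  then show ?case
    by (simp only: Suc.IH [symmetric] inv_falling_Suc [of "Suc n"])
qed

lemma shift_mellin_nth:
  "fps_nth (shift a (mellin h)) k = (\<Sum>n\<le>k. fps_nth h n * fps_nth (shift a (inv_falling n)) k)"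
proof -
  have "fps_nth (shift a (mellin h)) k = (\<Sum>i\<le>k. \<Sum>n\<le>k. fps_nth h n * (fps_nth (inv_falling n) i
      * fps_nth ((fps_X * inverse (lin (- a))) ^ i) k))"
    unfolding shift_nth
    by (intro sum.cong refl) (simp add: mellin_nth [of _ k] sum_distrib_right mult.assoc)
  also have "\<dots> = (\<Sum>n\<le>k. fps_nth h n * fps_nth (shift a (inv_falling n)) k)"
    unfolding shift_nth by (subst sum.swap) (simp add: sum_distrib_left)
  finally show ?thesis .
qed

text \<open>
  Shifts and multiplications by a fixed series act termwise on the infinite sum defining
  \<open>mellin h\<close>. Although it is infinite, each coefficient involves only finitely many summands.
\<close>

lemma mult_shift_mellin_nth:
  "fps_nth (q * shift a (mellin h)) k = (\<Sum>n\<le>k. fps_nth h n * fps_nth (q * shift a (inv_falling n)) k)"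
proof -
  have z: "fps_nth (shift a (inv_falling n)) j = 0" if "j < n" for n j
    unfolding shift_nth using that by (intro sum.neutral) (auto simp: inv_falling_nth_eq_0)
  have "fps_nth (shift a (mellin h)) j = (\<Sum>n\<le>k. fps_nth h n * fps_nth (shift a (inv_falling n)) j)" if "j \<le> k" for j
    unfolding shift_mellin_nth using that by (intro sum.mono_neutral_left) (auto simp: z)
  then have "fps_nth (q * shift a (mellin h)) k
     = (\<Sum>i\<le>k. \<Sum>n\<le>k. fps_nth h n * (fps_nth q i * fps_nth (shift a (inv_falling n)) (k - i)))"
    by (simp add: fps_mult_nth atLeast0AtMost sum_distrib_left mult_ac)
  also have "\<dots> = (\<Sum>n\<le>k. fps_nth h n * fps_nth (q * shift a (inv_falling n)) k)"
    by (subst sum.swap) (simp add: fps_mult_nth atLeast0AtMost sum_distrib_left)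
  finally show ?thesis .
qed

text \<open>
  Lowering the exponent of \<open>z\<close> by one replaces \<open>Z\<close> by \<open>Z - 1\<close> in the integral, and
  \<open>\<Gamma>(Z-1) / \<Gamma>(Z) = 1 / (Z-1)\<close>.
\<close>

lemma mellin_X_mult: "mellin (fps_X * h) = fps_X * inverse (lin 1) * shift (- 1) (mellin h)"
proof (rule fps_ext)
  fix k
  have "fps_nth (mellin (fps_X * h)) k = (\<Sum>n\<le>Suc k. fps_nth (fps_X * h) n * fps_nth (inv_falling n) k)"
    by (rule mellin_nth) simp
  also have "\<dots> = (\<Sum>n\<le>k. fps_nth h n * fps_nth (inv_falling (Suc n)) k)"
    by (subst sum.atMost_Suc_shift) simp
  also have "\<dots> = fps_nth (fps_X * inverse (lin 1) * shift (- 1) (mellin h)) k"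
    unfolding mult_shift_mellin_nth inv_falling_Suc_shift ..
  finally show "fps_nth (mellin (fps_X * h)) k = \<dots>" .
qed

lemma shift_inv_falling:
  "shift (- 1) (inv_falling n) = of_nat n * inv_falling (Suc n) + inv_falling n"
proof (rule fps_mult_right_cancel_rule)
  have l: "fps_X * inv_falling n = lin (of_nat (Suc n)) * inv_falling (Suc n)"
    by (simp add: inv_falling_Suc mult_ac)
  have "(of_nat n * inv_falling (Suc n) + inv_falling n) * fps_X
      = (of_nat n * fps_X + lin (of_nat (Suc n))) * inv_falling (Suc n)"
    by (simp only: distrib_right mult.commute [of _ fps_X] l distrib_left) (simp only: mult_ac)
  also have "of_nat n * fps_X + lin (of_nat (Suc n)) = (lin 1 :: complex fps)"
    by (simp add: lin_def algebra_simps fps_of_nat flip: fps_const_add)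
  also have "lin 1 * inv_falling (Suc n) = shift (- 1) (inv_falling n) * fps_X"
    by (simp add: inv_falling_Suc_shift mult_ac)
  finally show "shift (- 1) (inv_falling n) * fps_X
      = (of_nat n * inv_falling (Suc n) + inv_falling n) * fps_X" ..
qed simp

text \<open>
  The rule of integration by parts. In terms of \<open>\<theta> = x d/dx = -z d/dz\<close>, the left-hand side is the
  transform of \<open>x (\<theta> + z) h\<close>; the summand \<open>z\<close> comes from the derivative of \<open>e\<^sup>-\<^sup>z\<close>.
\<close>

lemma mellin_X_X_deriv:
  "mellin (fps_X * (fps_X * fps_deriv h)) + mellin h = shift (- 1) (mellin h)"
proof (rule fps_ext)
  fix k
  have "fps_nth (mellin (fps_X * (fps_X * fps_deriv h))) k
      = (\<Sum>n\<le>Suc k. fps_nth (fps_X * (fps_X * fps_deriv h)) n * fps_nth (inv_falling n) k)"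
    by (rule mellin_nth) simp
  also have "\<dots> = (\<Sum>n\<le>k. of_nat n * fps_nth h n * fps_nth (inv_falling (Suc n)) k)"
    by (subst sum.atMost_Suc_shift) (auto simp: fps_mult_fps_X_commute intro!: sum.cong split: nat.splits)
  finally have "fps_nth (mellin (fps_X * (fps_X * fps_deriv h)) + mellin h) k
      = (\<Sum>n\<le>k. fps_nth h n * fps_nth (of_nat n * inv_falling (Suc n) + inv_falling n) k)"
    by (simp add: mellin_nth [of k k] algebra_simps sum.distrib fps_mult_of_nat_nth)
  then show "fps_nth (mellin (fps_X * (fps_X * fps_deriv h)) + mellin h) k
      = fps_nth (shift (- 1) (mellin h)) k"
    unfolding shift_mellin_nth shift_inv_falling .
qed

lemma mellin_X_X_mult:
  "mellin (fps_X\<^sup>2 * h) = fps_X\<^sup>2 * inverse (lin 1) * inverse (lin 2) * shift (- 2) (mellin h)"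
proof -
  have "mellin (fps_X\<^sup>2 * h) = fps_X * inverse (lin 1)
      * shift (- 1) (fps_X * inverse (lin 1) * shift (- 1) (mellin h))"
    by (simp only: power2_eq_square mult.assoc mellin_X_mult)
  also have "\<dots> = fps_X\<^sup>2 * inverse (lin 1) * inverse (lin 2) * shift (- 2) (mellin h)"
    by (simp add: shift_mult shift_X shift_inverse shift_lin shift_shift fps_inverse_mult
        fps_inverse_idempotent mult_ac power2_eq_square)
  finally show ?thesis .
qed

lemma mellin_diff: "mellin (f - h) = mellin f - mellin h"
  using mellin_add [of "f - h" h] by simp

lemma one_plus_X_inverse_lin: "1 + fps_X * inverse (lin 1) = inverse (lin (1 :: complex))"
proof -
  have "(lin 1 + fps_X) * inverse (lin 1) = inverse (lin (1 :: complex))"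
    by (simp add: lin_def)
  then show ?thesis
    by (simp only: distrib_right lin_inverse)
qed

section \<open>The large-argument expansion of the Bessel function\<close>

text \<open>
  The series \<open>U(x)\<close> such that \<open>u = e\<^sup>-\<^sup>c\<^sup>z z\<^sup>-\<^sup>1\<^sup>/\<^sup>2 U(1/z)\<close>, with \<open>c = 1/p\<close>, is a formal solution of
  \<open>(z d/dz)\<^sup>2 u = (c\<^sup>2 z\<^sup>2 + N) u\<close>.
\<close>

definition hankel :: "complex \<Rightarrow> complex \<Rightarrow> complex fps" where
  "hankel N p = Abs_fps (\<lambda>k. a_coeff k N * p ^ k)"

text \<open>
  The series that represents \<open>-z\<^sup>-\<^sup>1 (z d/dz) u = -du/dz\<close> in the same normalisation as
  \<open>hankel\<close>. The factor \<open>z\<^sup>-\<^sup>1\<close> keeps it a power series in \<open>x\<close>.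
\<close>

definition hankel_deriv :: "complex \<Rightarrow> complex \<Rightarrow> complex fps" where
  "hankel_deriv N p = fps_const (1 / p) * hankel N p
     + fps_X * (fps_X * fps_deriv (hankel N p) + fps_const (1 / 2) * hankel N p)"

lemma F_conv_mellin: "F A B = mellin (hankel A (1 + \<i>) * hankel B (1 - \<i>))"
proof -
  have "G n A B = fps_nth (hankel A (1 + \<i>) * hankel B (1 - \<i>)) n" for n
    by (simp add: G_def fps_mult_nth hankel_def atLeast0AtMost mult_ac)
  then show ?thesis
    by (simp add: F_def mellin_def)
qed

lemma a_coeff_Suc: "8 * of_nat (Suc k) * a_coeff (Suc k) N = (4 * N - (2 * of_nat k + 1)\<^sup>2) * a_coeff k N"
proof -
  have "a_coeff (Suc k) N = (\<Prod>j<k. 4 * N - of_nat ((2 * j + 1)\<^sup>2)) * (4 * N - of_nat ((2 * k + 1)\<^sup>2))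
      / (8 * 8 ^ k * (of_nat (Suc k) * fact k))"
    by (simp only: a_coeff_def prod.lessThan_Suc power_Suc fact_Suc of_nat_mult)
  moreover have "of_nat (Suc k) \<noteq> (0 :: complex)"
    by (simp only: of_nat_eq_0_iff)
  ultimately show ?thesis
    by (simp add: a_coeff_def divide_simps del: of_nat_Suc) (simp add: algebra_simps)
qed

text \<open>
  With \<open>c = 1/p\<close> and \<open>\<theta> = x d/dx\<close> this is \<open>2 c U' + (\<theta> + 1/2)\<^sup>2 U = N U\<close>, the Bessel equation
  after the exponential factor has been removed. It is the recurrence of the \<open>a\<^sub>k\<close>.
\<close>

lemma hankel_ODE:
  assumes "p \<noteq> 0"
  shows "fps_const (2 / p) * fps_deriv (hankel N p)
      + fps_X * fps_deriv (fps_X * fps_deriv (hankel N p)) + fps_X * fps_deriv (hankel N p)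
      + fps_const (1 / 4) * hankel N p = fps_const N * hankel N p"
proof (rule fps_ext)
  fix k
  have X: "fps_nth (fps_X * fps_deriv f) n = of_nat n * fps_nth f n" for f :: "complex fps" and n
    by (simp add: fps_mult_fps_X_deriv_shift)
  have "2 * of_nat (Suc k) * a_coeff (Suc k) N + (of_nat k + 1 / 2)\<^sup>2 * a_coeff k N = N * a_coeff k N"
    using a_coeff_Suc [of k N] by (simp add: field_simps power2_eq_square)
  then have "(2 * of_nat (Suc k) * a_coeff (Suc k) N + (of_nat k + 1 / 2)\<^sup>2 * a_coeff k N) * p ^ k
      = N * a_coeff k N * p ^ k"
    by (simp only:)
  moreover have "2 / p * (x * (y * p ^ (k + 1))) = 2 * x * y * p ^ k" for x y
    using assms by simp
  moreover have "fps_nth (hankel N p) n = a_coeff n N * p ^ n" for n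
    by (simp add: hankel_def)
  ultimately show "fps_nth (fps_const (2 / p) * fps_deriv (hankel N p)
      + fps_X * fps_deriv (fps_X * fps_deriv (hankel N p)) + fps_X * fps_deriv (hankel N p)
      + fps_const (1 / 4) * hankel N p) k = fps_nth (fps_const N * hankel N p) k"
    by (simp only: fps_add_nth fps_mult_left_const_nth X fps_deriv_nth Suc_eq_plus1)
       (simp add: algebra_simps power2_eq_square)
qed

text \<open>
  The Groebner basis method used below treats fractional constants as atoms and needs their
  relations as hypotheses.
\<close>

lemma fps_half: "fps_const (1 / 2 :: complex) + fps_const (1 / 2) = 1"
  and fps_quarter: "fps_const (1 / 4 :: complex) = fps_const (1 / 2) * fps_const (1 / 2)"
  and fps_const_double: "fps_const (2 / p :: complex) = fps_const (1 / p) + fps_const (1 / p)"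
  by (simp_all add: fps_eq_iff add_divide_distrib)

lemma X_X_deriv_hankel:
  "fps_X * (fps_X * fps_deriv (hankel N p))
    = hankel_deriv N p - (fps_const (1 / p) + fps_X * fps_const (1 / 2)) * hankel N p"
  by (simp add: hankel_deriv_def algebra_simps)

text \<open>
  With the lemma before, the Bessel equation as a first-order system.
\<close>

lemma X_X_deriv_hankel_deriv:
  assumes "p \<noteq> 0"
  shows "fps_X * (fps_X * fps_deriv (hankel_deriv N p))
    = (fps_const ((1 / p)\<^sup>2) + fps_const N * fps_X\<^sup>2) * hankel N p
      + (fps_X * fps_const (1 / 2) - fps_const (1 / p)) * hankel_deriv N p"
proof -
  define u where "u = hankel N p"
  define u1 where "u1 = fps_deriv u"
  define u2 where "u2 = fps_deriv u1"
  define c where "c = fps_const (1 / p)"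
  define h where "h = fps_const (1 / 2 :: complex)"
  define n where "n = fps_const N"
  have h: "h + h = 1"
    unfolding h_def by (rule fps_half)
  have "(c + c) * u1 + fps_X * (fps_X * u2 + u1) + fps_X * u1 + h * h * u = n * u"
    using hankel_ODE [OF assms, of N]
    by (simp add: fps_quarter fps_const_double u_def u1_def u2_def c_def h_def n_def del: fps_const_mult fps_const_add)
  then have ode: "fps_X * (fps_X * ((c + c) * u1 + fps_X * (fps_X * u2 + u1) + fps_X * u1 + h * h * u)) = fps_X * (fps_X * (n * u))"
    by (simp only:)
  have d: "fps_deriv (c * u + fps_X * (fps_X * u1 + h * u)) =
      c * u1 + fps_X * (fps_X * u2 + u1 + h * u1) + fps_X * u1 + h * u"
    by (simp add: c_def h_def u1_def u2_def algebra_simps)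
  have sq: "fps_const ((1 / p)\<^sup>2) = c * c"
    by (simp add: c_def power2_eq_square)
  show ?thesis
    unfolding hankel_deriv_def sq u_def [symmetric] u1_def [symmetric] c_def [symmetric]
      h_def [symmetric] n_def [symmetric] d
    using ode h by algebra
qed

text \<open>
  The Leibniz rule for the four products of \<open>u\<close>, \<open>v\<close> and their derivatives. The left-hand sides are
  \<open>x (\<theta> + k + z)\<close> with \<open>k = 1, 0, 0, -1\<close>; each factor contributes \<open>1/2\<close> or \<open>-1/2\<close> to \<open>k\<close>, from
  its power of \<open>z\<close>, and the exponentials combine to \<open>e\<^sup>-\<^sup>z\<close> because \<open>1/p + 1/q = 1\<close>.
\<close>

lemma hankel_product_system:
  fixes A B p q :: complex and Y Y1 Y2 Y3 a' b' :: "complex fps"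
  assumes pq: "p \<noteq> 0" "q \<noteq> 0" "1 / p + 1 / q = 1"
  defines "Y \<equiv> hankel A p * hankel B q"
    and "Y1 \<equiv> hankel_deriv A p * hankel B q"
    and "Y2 \<equiv> hankel A p * hankel_deriv B q"
    and "Y3 \<equiv> hankel_deriv A p * hankel_deriv B q"
    and "a' \<equiv> fps_const ((1 / p)\<^sup>2) + fps_const A * fps_X\<^sup>2"
    and "b' \<equiv> fps_const ((1 / q)\<^sup>2) + fps_const B * fps_X\<^sup>2"
  shows "fps_X * (fps_X * fps_deriv Y) + Y + fps_X * Y = Y1 + Y2"
    and "fps_X * (fps_X * fps_deriv Y1) + Y1 = a' * Y + Y3"
    and "fps_X * (fps_X * fps_deriv Y2) + Y2 = b' * Y + Y3"
    and "fps_X * (fps_X * fps_deriv Y3) + Y3 - fps_X * Y3 = a' * Y2 + b' * Y1"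
proof -
  define c d h where "c = fps_const (1 / p)" "d = fps_const (1 / q)" "h = fps_const (1 / 2 :: complex)"
  have cd: "c + d = 1"
    unfolding c_d_h_def fps_const_add pq by simp
  have h: "h + h = 1"
    unfolding c_d_h_def by (rule fps_half)
  have leibniz: "fps_X * (fps_X * fps_deriv (f * k))
      = fps_X * (fps_X * fps_deriv f) * k + f * (fps_X * (fps_X * fps_deriv k))"
    for f k :: "complex fps"
    by (simp add: algebra_simps)
  note D = X_X_deriv_hankel [of A p] X_X_deriv_hankel [of B q]
    X_X_deriv_hankel_deriv [OF pq(1), of A] X_X_deriv_hankel_deriv [OF pq(2), of B]
  note simps = Y_def Y1_def Y2_def Y3_def leibniz D [folded a'_def b'_def c_d_h_def]
  show "fps_X * (fps_X * fps_deriv Y) + Y + fps_X * Y = Y1 + Y2"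
    unfolding simps using cd h by algebra
  show "fps_X * (fps_X * fps_deriv Y1) + Y1 = a' * Y + Y3"
    unfolding simps using cd h by algebra
  show "fps_X * (fps_X * fps_deriv Y2) + Y2 = b' * Y + Y3"
    unfolding simps using cd h by algebra
  show "fps_X * (fps_X * fps_deriv Y3) + Y3 - fps_X * Y3 = a' * Y2 + b' * Y1"
    unfolding simps using cd h by algebra
qed

section \<open>Difference system for the moments\<close>

text \<open>
  The transforms of the four products at \<open>B = 0\<close>, as functions of \<open>A\<close>. The two binary digits of the
  index tell which of the factors \<open>u\<close> (lower digit) and \<open>v\<close> (upper digit) is differentiated.
\<close>

definition moment :: "nat \<Rightarrow> complex \<Rightarrow> complex fps" where
  "moment k A = mellin ((if odd k then hankel_deriv A (1 + \<i>) else hankel A (1 + \<i>))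
      * (if k < 2 then hankel 0 (1 - \<i>) else hankel_deriv 0 (1 - \<i>)))"

lemma inv_falling_2: "inv_falling 2 = fps_X\<^sup>2 * inverse (lin 1) * inverse (lin 2)"
  by (simp add: inv_falling_def lin_def numeral_2_eq_2 power2_eq_square fps_of_nat mult_ac flip: numeral_fps_const)

text \<open>
  The transform of the differential system. Its two squared constants are \<open>1/p\<^sup>2 = -\<i>/2\<close> and
  \<open>1/q\<^sup>2 = \<i>/2\<close>; that they are opposite is what makes the elimination below short.
\<close>

lemma moment_system:
  fixes A :: complex
  defines "c \<equiv> fps_const (- \<i> / 2)"
  shows "shift (- 1) (moment 0 A) = lin 1 * (moment 1 A + moment 2 A)"
    and "shift (- 1) (moment 1 A) = c * moment 0 A + fps_const A * (inv_falling 2 * shift (- 2) (moment 0 A)) + moment 3 A"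
    and "shift (- 1) (moment 2 A) = moment 3 A - c * moment 0 A"
    and "lin 2 * inverse (lin 1) * shift (- 1) (moment 3 A)
      = c * (moment 2 A - moment 1 A) + fps_const A * (inv_falling 2 * shift (- 2) (moment 2 A))"
proof -
  define p q where "p = 1 + \<i>" and "q = 1 - \<i>"
  have pq: "p \<noteq> 0" "q \<noteq> 0" "1 / p + 1 / q = 1"
    by (auto simp: p_def q_def complex_eq_iff field_simps)
  have sq: "(1 / p)\<^sup>2 = - \<i> / 2" "(1 / q)\<^sup>2 = - (- \<i> / 2)"
    by (auto simp: p_def q_def complex_eq_iff power2_eq_square Re_divide Im_divide)
  note system = hankel_product_system [OF pq, of A 0]
  have moment: "mellin (hankel A p * hankel 0 q) = moment 0 A"
    "mellin (hankel_deriv A p * hankel 0 q) = moment 1 A"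
    "mellin (hankel A p * hankel_deriv 0 q) = moment 2 A"
    "mellin (hankel_deriv A p * hankel_deriv 0 q) = moment 3 A"
    by (simp_all add: moment_def p_def q_def)
  have "moment 1 A + moment 2 A = shift (- 1) (moment 0 A) * (1 + fps_X * inverse (lin 1))"
    using arg_cong [OF system(1), of mellin]
    by (simp only: mellin_add mellin_X_X_deriv)
       (simp only: mellin_X_mult moment, simp add: distrib_left mult_ac)
  then show "shift (- 1) (moment 0 A) = lin 1 * (moment 1 A + moment 2 A)"
    unfolding one_plus_X_inverse_lin by (simp add: mult_ac)
  show "shift (- 1) (moment 1 A) = c * moment 0 A + fps_const A * (inv_falling 2 * shift (- 2) (moment 0 A)) + moment 3 A"
    using arg_cong [OF system(2), of mellin]
    by (simp only: mellin_add mellin_X_X_deriv distrib_right mult.assoc)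
       (simp only: mellin_X_X_mult mellin_const_mult moment sq mult.assoc inv_falling_2 c_def)
  have "shift (- 1) (moment 2 A) = fps_const (- (- \<i> / 2)) * moment 0 A + moment 3 A"
    using arg_cong [OF system(3), of mellin]
    by (simp only: mellin_add mellin_X_X_deriv distrib_right mult.assoc)
       (simp only: mellin_const_mult moment sq, simp)
  then show "shift (- 1) (moment 2 A) = moment 3 A - c * moment 0 A"
    by (simp add: c_def flip: fps_const_neg)
  have "mellin (fps_X * (fps_X * fps_deriv (hankel_deriv A p * hankel_deriv 0 q))
        + hankel_deriv A p * hankel_deriv 0 q - fps_X * (hankel_deriv A p * hankel_deriv 0 q))
      = mellin (fps_const (- \<i> / 2) * (hankel A p * hankel_deriv 0 q)
        + fps_const A * (fps_X\<^sup>2 * (hankel A p * hankel_deriv 0 q))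
        + fps_const (- (- \<i> / 2)) * (hankel_deriv A p * hankel 0 q))"
    unfolding system(4) sq by (simp add: algebra_simps)
  then have eq: "shift (- 1) (moment 3 A) - fps_X * inverse (lin 1) * shift (- 1) (moment 3 A)
      = c * moment 2 A + fps_const A * (inv_falling 2 * shift (- 2) (moment 2 A)) + fps_const (- (- \<i> / 2)) * moment 1 A"
    by (simp only: mellin_add mellin_diff mellin_X_X_deriv)
       (simp only: mellin_X_mult mellin_X_X_mult mellin_const_mult moment inv_falling_2 c_def mult.assoc)
  have c: "fps_const (- (- \<i> / 2)) = - c"
    by (simp add: c_def)
  have "lin 2 = lin 1 - (fps_X :: complex fps)"
    by (simp add: lin_def numeral_fps_const algebra_simps)
  then have "lin 2 * inverse (lin 1) * shift (- 1) (moment 3 A)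
      = shift (- 1) (moment 3 A) - fps_X * inverse (lin 1) * shift (- 1) (moment 3 A)"
    by (simp add: left_diff_distrib)
  then show "lin 2 * inverse (lin 1) * shift (- 1) (moment 3 A)
      = c * (moment 2 A - moment 1 A) + fps_const A * (inv_falling 2 * shift (- 2) (moment 2 A))"
    unfolding eq c by (simp add: algebra_simps)
qed

text \<open>
  Both the system at \<open>A = 0\<close> and its derivative in \<open>A\<close> have this shape: the source terms \<open>s\<close> and
  \<open>r\<close> vanish in the first case and come from the terms with the factor \<open>A\<close> in the second. Shifting
  the equations and substituting them into each other eliminates everything but \<open>f0\<close>, and the
  constants combine to \<open>4 c\<^sup>2 = -1\<close>.
\<close>

lemma first_order_system_elimination:
  fixes f0 f1 f2 f3 r s c :: "complex fps"
  assumes c: "c = fps_const (- \<i> / 2)"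
    and E1: "shift (- 1) f0 = lin 1 * (f1 + f2)"
    and E2: "shift (- 1) f1 = c * f0 + s + f3"
    and E3: "shift (- 1) f2 = f3 - c * f0"
    and E4: "lin 2 * inverse (lin 1) * shift (- 1) f3 = c * (f2 - f1) + r"
  shows "shift (- 2) f0 = lin 2 * inverse (lin 1) * (f3 + f3 + s)"
    and "(lin 3)\<^sup>2 * shift (- 4) f0
      = lin 4 * (lin 2 * (f0 - 2 * c * s + 2 * shift (- 1) r) + lin 3 * shift (- 2) s)"
proof -
  let ?T = "shift (- 1) :: complex fps \<Rightarrow> complex fps"
  let ?i = "\<lambda>k. inverse (lin k) :: complex fps"
  have cc: "- 4 * (c * c) = 1"
    by (simp add: c numeral_fps_const flip: fps_const_neg)
  have Tc: "?T c = c"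
    by (simp add: c shift_const)
  have Tlin: "?T (lin 1) = lin 2 * ?i 1" "?T (lin 2) = lin 3 * ?i 1" "?T (lin 3) = lin 4 * ?i 1"
    by (simp_all add: shift_lin)
  have Tinv: "?T (?i 1) = lin 1 * ?i 2"
    by (simp add: shift_inverse shift_lin fps_inverse_mult fps_inverse_idempotent mult_ac)
  have TT: "?T (?T f) = shift (- 2) f" "?T (shift (- 2) f) = shift (- 3) f"
    "?T (shift (- 3) f) = shift (- 4) f" for f
    by (simp_all add: shift_shift)
  \<comment> \<open>In the sum of the shifted \<open>f1\<close> and \<open>f2\<close> the terms \<open>c * f0\<close> cancel, since they have opposite signs.\<close>
  have "?T (?T f0) = lin 2 * ?i 1 * (c * f0 + s + f3 + (f3 - c * f0))"
    by (simp only: E1 shift_mult shift_add Tlin E2 E3)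
  then show T2: "shift (- 2) f0 = lin 2 * ?i 1 * (f3 + f3 + s)"
    unfolding TT by (simp add: add_ac)
  have "?T (shift (- 2) f0) = (lin 3 * ?i 1) * (lin 1 * ?i 2) * (?T f3 + ?T f3 + ?T s)"
    by (simp only: T2 shift_mult shift_add Tlin Tinv)
  then have T3: "shift (- 3) f0 = lin 3 * (?i 2 * (?T f3 + ?T f3 + ?T s))"
    unfolding TT by (simp add: mult_ac)
  have f3: "lin 2 * ?T f3 = lin 1 * (c * (f2 - f1) + r)"
    unfolding E4 [symmetric] by (simp add: mult_ac)
  have "(lin 2)\<^sup>2 * shift (- 3) f0 = lin 3 * (lin 2 * (lin 2 * (?i 2 * (?T f3 + ?T f3 + ?T s))))"
    unfolding T3 by (simp only: power2_eq_square mult_ac)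
  also have "\<dots> = lin 3 * (lin 2 * ?T f3 + lin 2 * ?T f3 + lin 2 * ?T s)"
    by (simp only: lin_cancel distrib_left)
  finally have "?T ((lin 2)\<^sup>2 * shift (- 3) f0)
      = ?T (lin 3 * (lin 1 * (c * (f2 - f1) + r) + lin 1 * (c * (f2 - f1) + r) + lin 2 * ?T s))"
    by (simp only: f3)
  moreover define u where "u = c * (f3 - c * f0 - (c * f0 + s + f3)) + ?T r"
  ultimately have "(lin 3 * ?i 1)\<^sup>2 * shift (- 4) f0
      = lin 4 * ?i 1 * (lin 2 * ?i 1 * u + lin 2 * ?i 1 * u + lin 3 * ?i 1 * shift (- 2) s)"
    by (simp only: shift_mult shift_add shift_diff shift_power Tlin Tc E2 E3 TT)
  then have "((lin 3)\<^sup>2 * shift (- 4) f0) * (?i 1 * ?i 1)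
      = (lin 4 * (lin 2 * (u + u) + lin 3 * shift (- 2) s)) * (?i 1 * ?i 1)"
    by (simp only: power2_eq_square distrib_left distrib_right mult_ac)
  moreover have "?i 1 \<noteq> 0"
    using lin_inverse(1) [of "1 :: complex"] by force
  ultimately have "(lin 3)\<^sup>2 * shift (- 4) f0 = lin 4 * (lin 2 * (u + u) + lin 3 * shift (- 2) s)"
    by simp
  also have "u + u = (- 4 * (c * c)) * f0 - 2 * c * s + 2 * ?T r"
    by (simp add: u_def algebra_simps)
  finally show "(lin 3)\<^sup>2 * shift (- 4) f0
      = lin 4 * (lin 2 * (f0 - 2 * c * s + 2 * ?T r) + lin 3 * shift (- 2) s)"
    by (simp only: cc mult_1_left)
qed

section \<open>Derivatives in the parameter\<close>

text \<open>
  Coefficientwise differentiability at the origin of a family of series with one parameter.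
\<close>

definition has_param_deriv :: "(complex \<Rightarrow> complex fps) \<Rightarrow> complex fps \<Rightarrow> bool" where
  "has_param_deriv f f' \<longleftrightarrow>
     (\<forall>n. ((\<lambda>A. fps_nth (f A) n) has_field_derivative fps_nth f' n) (at 0))"

lemma has_param_deriv_unique: "has_param_deriv f f' \<Longrightarrow> has_param_deriv f f'' \<Longrightarrow> f' = f''"
  unfolding has_param_deriv_def by (intro fps_ext) (blast intro: DERIV_unique)

lemma has_param_deriv_const: "has_param_deriv (\<lambda>A. f) 0"
  by (simp add: has_param_deriv_def)

lemma has_param_deriv_param: "has_param_deriv fps_const 1"
  unfolding has_param_deriv_def
proof
  show "((\<lambda>A. fps_nth (fps_const A) n) has_field_derivative fps_nth 1 n) (at 0)" for n
    by (cases n) simp_all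
qed

lemma has_param_deriv_add:
  "has_param_deriv f f' \<Longrightarrow> has_param_deriv h h' \<Longrightarrow> has_param_deriv (\<lambda>A. f A + h A) (f' + h')"
  unfolding has_param_deriv_def by (auto intro!: DERIV_add)

lemma has_param_deriv_diff:
  "has_param_deriv f f' \<Longrightarrow> has_param_deriv h h' \<Longrightarrow> has_param_deriv (\<lambda>A. f A - h A) (f' - h')"
  unfolding has_param_deriv_def by (auto intro!: DERIV_diff)

lemma has_param_deriv_mult:
  assumes "has_param_deriv f f'" "has_param_deriv h h'"
  shows "has_param_deriv (\<lambda>A. f A * h A) (f' * h 0 + f 0 * h')"
  unfolding has_param_deriv_def
proof
  fix n
  have "((\<lambda>A. \<Sum>i=0..n. fps_nth (f A) i * fps_nth (h A) (n - i)) has_field_derivative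
      (\<Sum>i=0..n. fps_nth (f 0) i * fps_nth h' (n - i) + fps_nth f' i * fps_nth (h 0) (n - i))) (at 0)"
    using assms by (intro DERIV_sum DERIV_mult') (auto simp: has_param_deriv_def)
  then show "((\<lambda>A. fps_nth (f A * h A) n) has_field_derivative fps_nth (f' * h 0 + f 0 * h') n) (at 0)"
    by (simp add: fps_mult_nth sum.distrib add.commute)
qed

lemma has_param_deriv_const_mult:
  assumes "has_param_deriv f f'"
  shows "has_param_deriv (\<lambda>A. h * f A) (h * f')"
  using has_param_deriv_mult [OF has_param_deriv_const assms, of h] by simp

lemma has_param_deriv_shift:
  "has_param_deriv f f' \<Longrightarrow> has_param_deriv (\<lambda>A. shift a (f A)) (shift a f')"
  unfolding has_param_deriv_def shift_nth
  by (auto intro!: DERIV_sum DERIV_cmult_right)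

lemma has_param_deriv_mellin:
  "has_param_deriv f f' \<Longrightarrow> has_param_deriv (\<lambda>A. mellin (f A)) (mellin f')"
  unfolding has_param_deriv_def mellin_def fps_nth_Abs_fps
  by (auto intro!: DERIV_sum DERIV_cmult_right)

lemma has_param_deriv_fps_deriv:
  "has_param_deriv f f' \<Longrightarrow> has_param_deriv (\<lambda>A. fps_deriv (f A)) (fps_deriv f')"
  unfolding has_param_deriv_def fps_deriv_nth by (auto intro!: DERIV_cmult)

lemma has_param_deriv_hankel:
  "has_param_deriv (\<lambda>A. hankel A p) (Abs_fps (\<lambda>k. deriv (\<lambda>A. a_coeff k A) 0 * p ^ k))"
proof -
  have "(\<lambda>A. a_coeff k A) field_differentiable (at 0)" for k
    unfolding a_coeff_def divide_inverse
    by (intro holomorphic_on_imp_differentiable_at [of _ UNIV] holomorphic_intros) auto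
  then show ?thesis
    unfolding has_param_deriv_def hankel_def fps_nth_Abs_fps
    by (auto intro!: DERIV_cmult_right simp: field_differentiable_derivI)
qed

lemma has_param_deriv_power:
  assumes "has_param_deriv f f'"
  shows "has_param_deriv (\<lambda>A. f A ^ i) (of_nat i * (f 0 ^ (i - 1) * f'))"
proof (induction i)
  case 0
  then show ?case using has_param_deriv_const [of 1] by simp
next
  case (Suc i)
  have "f' * f 0 ^ i + f 0 * (of_nat i * (f 0 ^ (i - 1) * f')) = of_nat (Suc i) * (f 0 ^ (Suc i - 1) * f')"
    by (cases i) (simp_all add: algebra_simps)
  then show ?case
    using has_param_deriv_mult [OF assms Suc.IH] by simp
qed

text \<open>
  The chain rule for a fixed outer series. All inner series have zero constant term, so each
  coefficient of the composition is a finite sum of powers whose length is the same for all parameters.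
\<close>

lemma has_param_deriv_compose:
  assumes f: "has_param_deriv f f'" and f0: "\<And>A. fps_nth (f A) 0 = 0"
  shows "has_param_deriv (\<lambda>A. h oo f A) ((fps_deriv h oo f 0) * f')"
  unfolding has_param_deriv_def
proof
  fix n
  have low: "fps_nth (f A ^ i) j = 0" if "j < i" for A i j
    using f0 that by (simp add: startsby_zero_power_prefix)
  have c: "fps_nth (fps_deriv h oo f 0) j = (\<Sum>i\<le>n. fps_nth (fps_deriv h) i * fps_nth (f 0 ^ i) j)"
    if "j \<le> n" for j
    unfolding fps_compose_nth atLeast0AtMost
    using that by (intro sum.mono_neutral_left) (auto simp: low)
  have "fps_nth ((fps_deriv h oo f 0) * f') n
      = (\<Sum>j\<le>n. \<Sum>i\<le>n. fps_nth (fps_deriv h) i * (fps_nth (f 0 ^ i) j * fps_nth f' (n - j)))"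
    by (simp add: fps_mult_nth atLeast0AtMost c sum_distrib_right mult.assoc)
  also have "\<dots> = (\<Sum>i\<le>n. fps_nth (fps_deriv h) i * fps_nth (f 0 ^ i * f') n)"
    by (subst sum.swap) (simp add: fps_mult_nth atLeast0AtMost sum_distrib_left)
  also have "\<dots> = (\<Sum>i\<le>n. fps_nth h (Suc i) * fps_nth (of_nat (Suc i) * (f 0 ^ i * f')) n)"
  proof (rule sum.cong [OF refl])
    have "a * y * x = y * (a * x)" for a x y :: complex
      by simp
    then show "fps_nth (fps_deriv h) i * fps_nth (f 0 ^ i * f') n
        = fps_nth h (Suc i) * fps_nth (of_nat (Suc i) * (f 0 ^ i * f')) n" for i
      unfolding fps_mult_of_nat_nth fps_deriv_nth Suc_eq_plus1 .
  qed
  also have "\<dots> = (\<Sum>i\<le>Suc n. fps_nth h i * fps_nth (of_nat i * (f 0 ^ (i - 1) * f')) n)"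
    by (subst sum.atMost_Suc_shift) simp
  finally have eq: "fps_nth ((fps_deriv h oo f 0) * f') n = \<dots>" .
  \<comment> \<open>The summand with index \<open>n + 1\<close> is zero for every \<open>A\<close>; it aligns the range with that of the derivative.\<close>
  have "((\<lambda>A. \<Sum>i\<le>Suc n. fps_nth h i * fps_nth (f A ^ i) n) has_field_derivative
      (\<Sum>i\<le>Suc n. fps_nth h i * fps_nth (of_nat i * (f 0 ^ (i - 1) * f')) n)) (at 0)"
    using has_param_deriv_power [OF f] by (intro DERIV_sum DERIV_cmult) (auto simp: has_param_deriv_def)
  moreover have "fps_nth (h oo f A) n = (\<Sum>i\<le>Suc n. fps_nth h i * fps_nth (f A ^ i) n)" for A
    by (simp add: fps_compose_nth atLeast0AtMost low del: power_Suc)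
  ultimately show "((\<lambda>A. fps_nth (h oo f A) n) has_field_derivative fps_nth ((fps_deriv h oo f 0) * f') n) (at 0)"
    by (simp only: eq)
qed

section \<open>Difference equations at the origin of the parameter plane\<close>

lemma F_conv_moment: "F A 0 = moment 0 A"
  by (simp add: F_conv_mellin moment_def)

lemma moment_0_nth_0: "fps_nth (moment 0 A) 0 = 1"
  by (simp add: moment_def mellin_def inv_falling_def hankel_def a_coeff_def)

text \<open>
  The two-term recurrence \<open>F\<^sub>0(Z) = (Z-3)\<^sup>2 / ((Z-2)(Z-4)) F\<^sub>0(Z-4)\<close>: at \<open>A = 0\<close> the system has no
  source terms.
\<close>

lemma moment_0_recurrence: "(lin 3)\<^sup>2 * shift (- 4) (moment 0 0) = lin 4 * lin 2 * moment 0 0"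
  and shift_moment_0_conv_moment_3: "shift (- 2) (moment 0 0) = lin 2 * inverse (lin 1) * (moment 3 0 + moment 3 0)"
proof -
  note system = moment_system [of 0, simplified fps_const_0_eq_0 mult_zero_left add_0_right]
  show "(lin 3)\<^sup>2 * shift (- 4) (moment 0 0) = lin 4 * lin 2 * moment 0 0"
    using first_order_system_elimination(2)
      [OF refl, of "moment 0 0" "moment 1 0" "moment 2 0" 0 "moment 3 0" 0] system
    by (simp add: shift_def mult.assoc)
  show "shift (- 2) (moment 0 0) = lin 2 * inverse (lin 1) * (moment 3 0 + moment 3 0)"
    using first_order_system_elimination(1)
      [OF refl, of "moment 0 0" "moment 1 0" "moment 2 0" 0 "moment 3 0" 0] system
    by simp
qed

lemma has_param_deriv_hankel_deriv:
  "\<exists>d. has_param_deriv (\<lambda>A. hankel_deriv A p) d"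
proof -
  note h = has_param_deriv_hankel [of p]
  show ?thesis
    unfolding hankel_deriv_def
    by (rule exI, rule has_param_deriv_add [OF has_param_deriv_const_mult [OF h]
          has_param_deriv_const_mult [OF has_param_deriv_add
            [OF has_param_deriv_const_mult [OF has_param_deriv_fps_deriv [OF h]]
              has_param_deriv_const_mult [OF h]]]])
qed

lemma has_param_deriv_moment: "\<exists>d. has_param_deriv (moment k) d"
proof -
  have "\<exists>d. has_param_deriv (\<lambda>A. if odd k then hankel_deriv A (1 + \<i>) else hankel A (1 + \<i>)) d"
    using has_param_deriv_hankel_deriv has_param_deriv_hankel by (cases "odd k") auto
  then show ?thesis
    unfolding moment_def [abs_def]
    using has_param_deriv_mellin [OF has_param_deriv_mult [OF _ has_param_deriv_const]] by blast
qed

lemma shift_inv_falling_2: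
  "shift (- 1) (inv_falling 2) = fps_X\<^sup>2 * inverse (lin 2) * inverse (lin 3)"
  "shift (- 2) (inv_falling 2) = fps_X\<^sup>2 * inverse (lin 3) * inverse (lin 4)"
  by (simp_all add: inv_falling_2 shift_mult shift_power shift_X shift_inverse shift_lin
      fps_inverse_mult fps_inverse_idempotent mult_ac power2_eq_square)

text \<open>
  The source terms involve \<open>F\<^sub>0\<close> and the moment of \<open>u v'\<close>, which the system at \<open>A = 0\<close> expresses by
  shifts of \<open>F\<^sub>0\<close> again.
\<close>

lemma param_deriv_recurrence:
  assumes n: "has_param_deriv (moment 0) n"
  shows "(lin 3)\<^sup>2 * shift (- 4) n = lin 4 * lin 2 * n
    + fps_const (2 * \<i>) * fps_X\<^sup>2 * inverse (lin 1) * inverse (lin 3) * (lin 4 * lin 2) * shift (- 2) (moment 0 0)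
    + 2 * fps_X\<^sup>2 * shift (- 4) (moment 0 0)"
proof -
  define c where "c = fps_const (- \<i> / 2)"
  let ?i = "\<lambda>k. inverse (lin k) :: complex fps"
  let ?m = "moment 0 0"
  define s where "s = inv_falling 2 * shift (- 2) ?m"
  define r where "r = inv_falling 2 * shift (- 2) (moment 2 0)"
  obtain n1 n2 n3 where n1: "has_param_deriv (moment 1) n1" and n2: "has_param_deriv (moment 2) n2"
    and n3: "has_param_deriv (moment 3) n3"
    using has_param_deriv_moment by meson
  have source: "has_param_deriv (\<lambda>A. fps_const A * (inv_falling 2 * shift (- 2) (moment k A)))
      (inv_falling 2 * shift (- 2) (moment k 0))" for k
  proof -
    obtain d where "has_param_deriv (moment k) d"
      using has_param_deriv_moment by blast
    from has_param_deriv_mult [OF has_param_deriv_param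
        has_param_deriv_const_mult [OF has_param_deriv_shift [OF this]], of "inv_falling 2" "- 2"]
    show ?thesis by simp
  qed
  have E1: "shift (- 1) n = lin 1 * (n1 + n2)"
    by (rule has_param_deriv_unique [OF has_param_deriv_shift [OF n]])
       (simp only: moment_system(1), intro has_param_deriv_const_mult has_param_deriv_add n1 n2)
  have E2: "shift (- 1) n1 = c * n + s + n3"
    by (rule has_param_deriv_unique [OF has_param_deriv_shift [OF n1]], unfold c_def s_def)
       (simp only: moment_system(2), intro has_param_deriv_const_mult has_param_deriv_add source n n3)
  have E3: "shift (- 1) n2 = n3 - c * n"
    by (rule has_param_deriv_unique [OF has_param_deriv_shift [OF n2]], unfold c_def)
       (simp only: moment_system(3), intro has_param_deriv_const_mult has_param_deriv_diff n n3)
  have E4: "lin 2 * ?i 1 * shift (- 1) n3 = c * (n2 - n1) + r"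
    by (rule has_param_deriv_unique [OF has_param_deriv_const_mult [OF has_param_deriv_shift [OF n3]]],
        unfold c_def r_def)
       (simp only: moment_system(4),
        intro has_param_deriv_const_mult has_param_deriv_add has_param_deriv_diff source n1 n2)
  have "shift (- 2) (shift (- 1) (moment 2 0)) = shift (- 2) (moment 3 0) - c * shift (- 2) ?m"
    by (simp only: moment_system(3) shift_diff shift_mult shift_const c_def)
  then have m2: "shift (- 3) (moment 2 0) = shift (- 2) (moment 3 0) - c * shift (- 2) ?m"
    by (simp add: shift_shift)
  have "shift (- 2) (shift (- 2) ?m) = lin 4 * ?i 3 * (shift (- 2) (moment 3 0) + shift (- 2) (moment 3 0))"
    unfolding shift_moment_0_conv_moment_3
    by (simp add: shift_mult shift_numeral shift_add shift_lin shift_inverse fps_inverse_mult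
        fps_inverse_idempotent mult_ac)
  then have m3: "lin 4 * (shift (- 2) (moment 3 0) + shift (- 2) (moment 3 0)) = lin 3 * shift (- 4) ?m"
    by (simp add: shift_shift mult_ac)
  have "shift (- 1) r + shift (- 1) r = fps_X\<^sup>2 * ?i 2 * ?i 3
      * (shift (- 3) (moment 2 0) + shift (- 3) (moment 2 0))"
    by (simp add: r_def shift_mult shift_inv_falling_2 shift_shift distrib_left)
  also have "shift (- 3) (moment 2 0) + shift (- 3) (moment 2 0)
      = (shift (- 2) (moment 3 0) + shift (- 2) (moment 3 0)) - 2 * c * shift (- 2) ?m"
    by (simp add: m2 algebra_simps)
  finally have r: "lin 4 * lin 2 * (2 * shift (- 1) r)
      = fps_X\<^sup>2 * shift (- 4) ?m - 2 * c * (fps_X\<^sup>2 * lin 4 * ?i 3 * shift (- 2) ?m)"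
  proof -
    assume *: "shift (- 1) r + shift (- 1) r = fps_X\<^sup>2 * ?i 2 * ?i 3
      * ((shift (- 2) (moment 3 0) + shift (- 2) (moment 3 0)) - 2 * c * shift (- 2) ?m)"
    have "lin 4 * lin 2 * (2 * shift (- 1) r)
       = lin 2 * (?i 2 * (fps_X\<^sup>2 * ?i 3 * (lin 4 * (shift (- 2) (moment 3 0) + shift (- 2) (moment 3 0)))
          - 2 * c * (fps_X\<^sup>2 * lin 4 * ?i 3 * shift (- 2) ?m)))"
      unfolding mult_2 [of "shift (- 1) r"] * by (simp only: right_diff_distrib mult_ac)
    also have "\<dots> = fps_X\<^sup>2 * ?i 3 * (lin 3 * shift (- 4) ?m)
          - 2 * c * (fps_X\<^sup>2 * lin 4 * ?i 3 * shift (- 2) ?m)"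
      by (simp only: lin_cancel m3)
    finally show ?thesis
      by (simp only: mult.assoc lin_cancel)
  qed
  have "shift (- 2) s = fps_X\<^sup>2 * ?i 3 * ?i 4 * shift (- 4) ?m"
    by (simp add: s_def shift_mult shift_inv_falling_2 shift_shift)
  then have s2: "lin 4 * lin 3 * shift (- 2) s = fps_X\<^sup>2 * shift (- 4) ?m"
    by (simp add: mult_ac)
  have s: "lin 4 * lin 2 * (2 * c * s) = 2 * c * (fps_X\<^sup>2 * lin 4 * ?i 1 * shift (- 2) ?m)"
    by (simp add: s_def inv_falling_2 mult_ac)
  have "?i 1 + ?i 3 = ?i 1 * ?i 3 * (lin 3 + lin 1)"
    by (simp add: distrib_left mult_ac)
  also have "lin 3 + lin 1 = lin 2 + (lin 2 :: complex fps)"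
    by (simp add: lin_def numeral_fps_const algebra_simps)
  finally have i13: "?i 1 + ?i 3 = ?i 1 * ?i 3 * (lin 2 + lin 2)" .
  have "(lin 3)\<^sup>2 * shift (- 4) n
      = lin 4 * (lin 2 * (n - 2 * c * s + 2 * shift (- 1) r) + lin 3 * shift (- 2) s)"
    by (rule first_order_system_elimination(2) [OF c_def E1 E2 E3 E4])
  also have "\<dots> = lin 4 * lin 2 * n - lin 4 * lin 2 * (2 * c * s)
      + lin 4 * lin 2 * (2 * shift (- 1) r) + lin 4 * lin 3 * shift (- 2) s"
    by (simp only: distrib_left right_diff_distrib mult.assoc)
  also have "\<dots> = lin 4 * lin 2 * n
      + (- 2 * c) * fps_X\<^sup>2 * (?i 1 + ?i 3) * lin 4 * shift (- 2) ?m + 2 * fps_X\<^sup>2 * shift (- 4) ?m"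
    unfolding r s s2 by (simp add: algebra_simps)
  also have "(- 2 * c) * fps_X\<^sup>2 * (?i 1 + ?i 3) * lin 4 * shift (- 2) ?m
      = (- 4 * c) * fps_X\<^sup>2 * ?i 1 * ?i 3 * (lin 4 * lin 2) * shift (- 2) ?m"
    unfolding i13 by (simp add: mult_ac)
  also have "- 4 * c = fps_const (2 * \<i>)"
    by (simp add: c_def numeral_fps_const flip: fps_const_neg)
  finally show ?thesis .
qed

text \<open>
  The logarithmic derivative of \<open>F\<close> in \<open>A\<close>.
\<close>

lemma g_conv_param_deriv:
  assumes n: "has_param_deriv (moment 0) n"
  shows "Abs_fps g = n * inverse (moment 0 0)"
proof (rule fps_ext)
  fix k
  have "has_param_deriv (\<lambda>A. F A 0 - 1) n"
    using has_param_deriv_diff [OF n has_param_deriv_const [of 1]] by (simp add: F_conv_moment)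
  then have "has_param_deriv (\<lambda>A. fps_ln 1 oo (F A 0 - 1)) ((fps_deriv (fps_ln 1) oo (F 0 0 - 1)) * n)"
    by (rule has_param_deriv_compose) (simp add: F_conv_moment moment_0_nth_0)
  moreover have "fps_deriv (fps_ln 1) oo (F 0 0 - 1) = inverse (moment 0 0)"
  proof -
    have "inverse (1 + fps_X) oo (F 0 0 - 1) = inverse ((1 + fps_X) oo (F 0 0 - 1))"
      by (rule fps_inverse_compose) (simp_all add: F_conv_moment moment_0_nth_0)
    then show ?thesis
      by (simp add: fps_ln_deriv fps_compose_add_distrib F_conv_moment moment_0_nth_0)
  qed
  ultimately have "((\<lambda>A. L k A 0) has_field_derivative fps_nth (inverse (moment 0 0) * n) k) (at 0)"
    by (simp add: has_param_deriv_def L_def)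
  then have "g k = fps_nth (inverse (moment 0 0) * n) k"
    unfolding g_def by (rule DERIV_imp_deriv)
  then show "fps_nth (Abs_fps g) k = fps_nth (n * inverse (moment 0 0)) k"
    by (simp add: mult.commute)
qed

definition moment_ratio :: "complex fps" where
  "moment_ratio = moment 0 0 * inverse (shift 2 (moment 0 0))"

text \<open>
  Dividing the recurrence for \<open>\<partial>\<^sub>A F\<close> by the one for \<open>F\<^sub>0\<close> gives an equation between \<open>R(Z-4)\<close> and
  \<open>R(Z)\<close>. The shift by \<open>2\<close> makes it symmetric, as the hyperbolic sine demands.
\<close>

lemma g_difference_equation:
  "shift (- 2) (Abs_fps g) - shift 2 (Abs_fps g)
    = fps_const 2 * (fps_X\<^sup>2 * inverse (lin 1) * inverse (lin 1))
      + fps_const (2 * \<i>) * (fps_X\<^sup>2 * inverse (lin (- 1)) * inverse (lin 1) * moment_ratio)"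
proof -
  obtain n where n: "has_param_deriv (moment 0) n"
    using has_param_deriv_moment by blast
  let ?i = "\<lambda>k. inverse (lin k) :: complex fps"
  let ?m = "moment 0 0"
  define m4 R where "m4 = shift (- 4) ?m" and "R = Abs_fps g"
  have [simp]: "?m * inverse ?m = 1" "m4 * inverse m4 = 1"
    by (simp_all add: inverse_mult_eq_1' moment_0_nth_0 m4_def)
  have R: "R = n * inverse ?m"
    unfolding R_def by (rule g_conv_param_deriv [OF n])
  have n_eq: "n = R * ?m"
    unfolding R by (simp add: mult_ac flip: mult.assoc [of n])
  have n4: "shift (- 4) n = shift (- 4) R * m4"
    by (simp add: n_eq shift_mult m4_def)
  have rec: "lin 4 * lin 2 * ?m = (lin 3)\<^sup>2 * m4"
    by (simp add: moment_0_recurrence m4_def)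
  have "(lin 3)\<^sup>2 * (shift (- 4) R * m4) = lin 4 * lin 2 * (R * ?m)
    + fps_const (2 * \<i>) * fps_X\<^sup>2 * ?i 1 * ?i 3 * (lin 4 * lin 2) * (?m * inverse ?m) * shift (- 2) ?m
    + 2 * fps_X\<^sup>2 * m4"
    using param_deriv_recurrence [OF n] unfolding n4 by (simp flip: m4_def n_eq)
  also have "lin 4 * lin 2 * (R * ?m) = R * (lin 4 * lin 2 * ?m)"
    by (simp only: mult_ac)
  also have "fps_const (2 * \<i>) * fps_X\<^sup>2 * ?i 1 * ?i 3 * (lin 4 * lin 2) * (?m * inverse ?m) * shift (- 2) ?m
      = fps_const (2 * \<i>) * fps_X\<^sup>2 * ?i 1 * ?i 3 * (lin 4 * lin 2 * ?m) * inverse ?m * shift (- 2) ?m"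
    by (simp only: mult_ac)
  also have "2 * fps_X\<^sup>2 * m4 = 2 * fps_X\<^sup>2 * ((lin 3 * ?i 3) * (lin 3 * ?i 3)) * m4"
    by simp
  finally have "shift (- 4) R * ((lin 3)\<^sup>2 * m4) = (R
      + fps_const (2 * \<i>) * fps_X\<^sup>2 * ?i 1 * ?i 3 * inverse ?m * shift (- 2) ?m
      + 2 * fps_X\<^sup>2 * (?i 3 * ?i 3)) * ((lin 3)\<^sup>2 * m4)"
    unfolding rec by (simp only: distrib_right distrib_left power2_eq_square mult_ac)
  moreover have "m4 \<noteq> 0"
    using \<open>m4 * inverse m4 = 1\<close> by force
  ultimately have T4: "shift (- 4) R = R
      + fps_const (2 * \<i>) * fps_X\<^sup>2 * ?i 1 * ?i 3 * inverse ?m * shift (- 2) ?m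
      + 2 * fps_X\<^sup>2 * (?i 3 * ?i 3)"
    by simp
  have "shift 2 (shift (- 4) R) = shift 2 R
      + fps_const (2 * \<i>) * (fps_X * ?i (- 2))\<^sup>2 * (lin (- 2) * ?i (- 1)) * (lin (- 2) * ?i 1) * inverse (shift 2 ?m) * ?m
      + 2 * (fps_X * ?i (- 2))\<^sup>2 * (lin (- 2) * ?i 1 * (lin (- 2) * ?i 1))"
    by (subst T4) (simp add: shift_add shift_mult shift_power shift_X shift_inverse shift_lin shift_const
        shift_shift shift_numeral fps_inverse_mult fps_inverse_idempotent moment_0_nth_0 mult_ac)
  also have "(fps_X * ?i (- 2))\<^sup>2 = fps_X\<^sup>2 * (?i (- 2) * ?i (- 2))"
    by (simp only: power2_eq_square mult_ac)
  finally have "shift 2 (shift (- 4) R) = shift 2 R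
      + fps_const (2 * \<i>) * (fps_X\<^sup>2 * ?i (- 1) * ?i 1 * moment_ratio)
      + 2 * (fps_X\<^sup>2 * ?i 1 * ?i 1)"
    by (simp add: moment_ratio_def mult_ac)
  then show ?thesis
    by (simp add: shift_shift R_def numeral_fps_const add_ac)
qed

text \<open>
  The transform of \<open>sinh(2t) \<Phi>(t)/t\<close> is half of the left-hand side of the difference equation. Its
  two source terms are the transform of \<open>t e\<^sup>t\<close> and \<open>\<i>\<close> times the transform of \<open>t W(t)\<close>.
\<close>

lemma W_nth:
  "fps_nth W n = fps_nth (fps_X\<^sup>2 * inverse (lin (- 1)) * inverse (lin 1) * moment_ratio) (n + 2) / fact (n + 1)"
proof -
  define K where "K = fps_X\<^sup>2 * inverse (lin (- 1)) * inverse (lin 1) * moment_ratio"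
  define phi where "phi = Abs_fps (\<lambda>n. g (Suc n) / fact n)"
  define f where "f = sinh_2t * phi"
  have "L 0 A 0 = 0" for A
    by (simp add: L_def)
  then have g0: "g 0 = 0"
    by (simp add: g_def)
  have lap: "laplace phi = Abs_fps g"
  proof (rule fps_ext)
    show "fps_nth (laplace phi) k = fps_nth (Abs_fps g) k" for k
      by (cases k) (simp_all add: phi_def g0)
  qed
  have X2: "fps_X\<^sup>2 * inverse (lin 1) * inverse (lin 1) = laplace (fps_exp 1 * (fps_X :: complex fps))"
  proof -
    have "laplace (fps_X :: complex fps) = fps_X\<^sup>2"
    proof (rule fps_ext)
      show "fps_nth (laplace fps_X) k = fps_nth (fps_X\<^sup>2 :: complex fps) k" for k
        by (cases k) (auto simp: fps_X_power_nth)
    qed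
    then show ?thesis
      using laplace_exp_mult [of "- 1" "fps_X :: complex fps"]
      by (simp add: shift_mult shift_X power2_eq_square mult_ac)
  qed
  have "fps_const 2 * f = fps_exp (- (- 2)) * phi - fps_exp (- 2) * phi"
  proof -
    have "fps_const 2 * fps_const (1 / 2) = (1 :: complex fps)"
      by simp
    then have "fps_const 2 * f = (fps_exp 2 - fps_exp (- 2)) * phi"
      unfolding f_def sinh_2t_def by (metis mult.assoc mult_1_left)
    then show ?thesis
      by (simp add: left_diff_distrib)
  qed
  then have "fps_const 2 * laplace f = shift (- 2) (Abs_fps g) - shift 2 (Abs_fps g)"
    by (metis laplace_const_mult laplace_diff laplace_exp_mult lap)
  also have "\<dots> = fps_const 2 * (laplace (fps_exp 1 * fps_X) + fps_const \<i> * K)"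
    unfolding g_difference_equation X2 K_def by (simp add: distrib_left mult.assoc [symmetric])
  finally have lf: "laplace f = laplace (fps_exp 1 * fps_X) + fps_const \<i> * K"
    by simp
  have f_nth: "fact k * fps_nth f k = fact k * fps_nth (fps_exp 1 * fps_X) k + \<i> * fps_nth K (Suc k)" for k
    using arg_cong [OF lf, of "\<lambda>x. fps_nth x (Suc k)"] by simp
  have "fps_nth f 0 = 0"
    by (simp add: f_def sinh_2t_def)
  then have f_eq: "f = fps_X * fps_shift 1 f"
    by (simp add: fps_eq_iff split: nat.splits)
  have "Phi = fps_X * phi"
    by (rule fps_ext) (auto simp: Phi_def phi_def fps_mult_fps_X_commute split: nat.splits)
  then have "sinh_2t * Phi = fps_X * f"
    by (simp add: f_def mult_ac)
  also have "\<dots> = fps_shift 1 f * fps_X\<^sup>2"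
    by (subst f_eq) (simp only: power2_eq_square mult_ac)
  finally have "sinh_2t * Phi / fps_X\<^sup>2 = fps_shift 1 f"
    by simp
  then have "fps_nth W n = - \<i> * (fps_nth f (Suc n) - 1 / fact n)"
    by (simp add: W_def)
  moreover have "fps_nth f (Suc n) = 1 / fact n + \<i> * fps_nth K (n + 2) / fact (Suc n)"
  proof -
    have "fact (Suc n) * fps_nth f (Suc n) = fact (Suc n) * (1 / fact n + \<i> * fps_nth K (n + 2) / fact (Suc n))"
      using f_nth [of "Suc n"] by (simp add: distrib_left del: fact_Suc)
    then show ?thesis
      by (simp del: fact_Suc)
  qed
  ultimately show ?thesis
    by (simp add: K_def [symmetric] del: fact_Suc)
qed

section \<open>Hyperbolic tangent and Bernoulli numbers\<close>

text \<open>
  The quotient form \<open>(e\<^sup>2\<^sup>t - 1) / (e\<^sup>2\<^sup>t + 1)\<close> has an invertible denominator.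
\<close>

definition tanh_fps :: "'a::field_char_0 fps" where
  "tanh_fps = (fps_exp 2 - 1) * inverse (fps_exp 2 + 1)"

lemma tanh_fps_mult: "tanh_fps * (fps_exp 2 + 1) = fps_exp 2 - (1 :: 'a::field_char_0 fps)"
proof -
  have "inverse (fps_exp 2 + 1) * (fps_exp 2 + 1) = (1 :: 'a fps)"
    by (rule inverse_mult_eq_1) simp
  then show ?thesis
    by (simp add: tanh_fps_def mult.assoc)
qed

lemma exp_plus_1_neq_0: "fps_exp 2 + 1 \<noteq> (0 :: 'a::field_char_0 fps)"
proof
  assume "fps_exp 2 + 1 = (0 :: 'a fps)"
  then have "fps_nth (fps_exp 2 + 1 :: 'a fps) 0 = 0"
    by simp
  then show False
    by simp
qed

lemma tanh_fps_nth_0: "fps_nth tanh_fps 0 = 0"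
  by (simp add: tanh_fps_def)

lemma tanh_fps_deriv: "fps_deriv tanh_fps = 1 - (tanh_fps :: 'a::field_char_0 fps)\<^sup>2"
proof (rule fps_mult_right_cancel_rule)
  let ?E = "fps_exp 2 :: 'a fps" and ?t = "tanh_fps :: 'a fps"
  have t: "?t * (?E + 1) = ?E - 1"
    by (rule tanh_fps_mult)
  have "fps_deriv (?t * (?E + 1)) = fps_deriv (?E - 1)"
    using t by simp
  then have d: "fps_deriv ?t * (?E + 1) = 2 * ?E - ?t * (2 * ?E)"
    by (simp add: algebra_simps numeral_fps_const)
  have "(1 - ?t\<^sup>2) * (?E + 1)\<^sup>2 = (?E + 1)\<^sup>2 - (?t * (?E + 1))\<^sup>2"
    by (simp add: algebra_simps power2_eq_square)
  also have "\<dots> = 4 * ?E"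
    unfolding t by (simp add: algebra_simps power2_eq_square)
  also have "\<dots> = 2 * ?E * (?E + 1) - 2 * ?E * (?t * (?E + 1))"
    unfolding t by (simp add: algebra_simps)
  also have "\<dots> = fps_deriv ?t * (?E + 1)\<^sup>2"
    using arg_cong [OF d, of "\<lambda>x. x * (?E + 1)"] by (simp add: algebra_simps power2_eq_square)
  finally show "fps_deriv ?t * (?E + 1)\<^sup>2 = (1 - ?t\<^sup>2) * (?E + 1)\<^sup>2" ..
  show "(?E + 1)\<^sup>2 \<noteq> 0"
    using exp_plus_1_neq_0 by simp
qed

lemma tanh_fps_nth_even: "even n \<Longrightarrow> fps_nth (tanh_fps :: 'a::field_char_0 fps) n = 0"
proof -
  let ?E = "fps_exp 2 :: 'a fps" and ?t = "tanh_fps :: 'a fps"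
  have ee: "fps_exp (- 2) * ?E = 1"
    using fps_exp_add_mult [of "- 2 :: 'a" 2] by simp
  have "(?t oo - fps_X) * (?E + 1) = - ?t * (?E + 1)"
  proof -
    have "(?t * (?E + 1)) oo - fps_X = (?E - 1) oo - fps_X"
      by (simp add: tanh_fps_mult)
    then have "(?t oo - fps_X) * (fps_exp (- 2) + 1) = fps_exp (- 2) - 1"
      by (simp add: fps_compose_mult_distrib fps_compose_add_distrib fps_compose_sub_distrib)
    then have "(?t oo - fps_X) * (fps_exp (- 2) * ?E + ?E) = fps_exp (- 2) * ?E - ?E"
      by (metis (no_types, lifting) mult.assoc distrib_right left_diff_distrib mult_1_left)
    then show ?thesis
      unfolding ee mult_minus_left tanh_fps_mult by (simp only: add.commute minus_diff_eq)
  qed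
  then have "?t oo - fps_X = - ?t"
    using exp_plus_1_neq_0 by (rule fps_mult_right_cancel_rule)
  then have "(- 1) ^ n * fps_nth ?t n = - fps_nth ?t n"
    by (simp add: fps_compose_uminus' fps_eq_iff)
  then show "even n \<Longrightarrow> fps_nth ?t n = 0"
    by simp
qed

definition beta :: "rat fps" where
  "beta = Abs_fps (\<lambda>k. if odd k then b ((k + 1) div 2) else 0)"

text \<open>
  From \<open>x / (e\<^sup>x + 1) = x / (e\<^sup>x - 1) - 2x / (e\<^sup>2\<^sup>x - 1)\<close> at \<open>x = 2t\<close>, together with
  \<open>t tanh t = t - 2t / (e\<^sup>2\<^sup>t + 1)\<close>. The exception \<open>n = 1\<close> is the linear term \<open>t\<close>.
\<close>

lemma tanh_fps_nth_bernoulli: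
  assumes "n \<ge> 2"
  shows "fps_nth tanh_fps (n - 1) = (2 ^ n - 1) * 2 ^ n * bernoulli n / fact n"
proof -
  define q where "q = (fps_X / (fps_exp 1 - 1) :: rat fps)"
  define r where "r = Abs_fps (\<lambda>n. 1 / fact (Suc n) :: rat)"
  have "fps_X * r = fps_exp 1 - 1"
    by (rule fps_ext) (auto simp: r_def fps_mult_fps_X_commute split: nat.splits simp del: fact_Suc)
  moreover have "r * inverse r = 1"
    by (rule inverse_mult_eq_1') (simp add: r_def)
  ultimately have "fps_X = (fps_exp 1 - 1) * inverse r"
    by (metis mult.assoc mult.right_neutral)
  then have "fps_exp 1 - 1 dvd (fps_X :: rat fps)"
    by (rule dvdI)
  then have q: "q * (fps_exp 1 - 1) = fps_X"
    by (simp add: q_def)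
  define q2 where "q2 = q oo (fps_const 2 * fps_X)"
  define q4 where "q4 = q oo (fps_const 4 * fps_X)"
  have q2: "q2 * (fps_exp 2 - 1) = fps_const 2 * fps_X"
    using arg_cong [OF q, of "\<lambda>f. f oo (fps_const 2 * fps_X)"]
    by (simp add: q2_def fps_compose_mult_distrib fps_compose_sub_distrib)
  have q4: "q4 * (fps_exp 4 - 1) = fps_const 4 * fps_X"
    using arg_cong [OF q, of "\<lambda>f. f oo (fps_const 4 * fps_X)"]
    by (simp add: q4_def fps_compose_mult_distrib fps_compose_sub_distrib)
  have e4: "fps_exp 4 = fps_exp 2 * (fps_exp 2 :: rat fps)"
    using fps_exp_add_mult [of "2 :: rat" 2] by simp
  have "fps_X * tanh_fps = fps_X - (q2 - q4)"
  proof (rule fps_mult_right_cancel_rule)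
    let ?E = "fps_exp 2 :: rat fps"
    have "(fps_X - (q2 - q4)) * ((?E + 1) * (?E - 1))
        = fps_X * (?E + 1) * (?E - 1) - (q2 * (?E - 1)) * (?E + 1) + q4 * (?E * ?E - 1)"
      by (simp add: algebra_simps)
    also have "\<dots> = fps_X * (?E - 1) * (?E - 1)"
      unfolding q2 q4 [unfolded e4] by (simp add: algebra_simps flip: numeral_fps_const)
    also have "\<dots> = fps_X * tanh_fps * ((?E + 1) * (?E - 1))"
      by (simp flip: tanh_fps_mult add: mult_ac)
    finally show "fps_X * tanh_fps * ((?E + 1) * (?E - 1)) = (fps_X - (q2 - q4)) * ((?E + 1) * (?E - 1))" ..
    show "(?E + 1) * (?E - 1) \<noteq> 0"
      using exp_plus_1_neq_0 [where 'a = rat] by simp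
  qed
  then have "fps_nth (fps_X * tanh_fps) n = fps_nth (fps_X - (q2 - q4)) n"
    by simp
  then have "fps_nth tanh_fps (n - 1) = 4 ^ n * fps_nth q n - 2 ^ n * fps_nth q n"
    using assms by (simp add: q2_def q4_def)
  moreover have "(4 :: rat) ^ n = 2 ^ n * 2 ^ n"
    by (simp flip: power_mult_distrib)
  moreover have "bernoulli n / fact n = fps_nth q n"
    by (simp add: bernoulli_def q_def)
  ultimately have "fps_nth tanh_fps (n - 1) = (2 ^ n - 1) * 2 ^ n * (bernoulli n / fact n)"
    by (simp only: left_diff_distrib mult_1_left)
  then show ?thesis
    by simp
qed

lemma beta_nth_0: "fps_nth beta 0 = 0"
  by (simp add: beta_def)

text \<open>
  This exhibits \<open>beta\<close> as the Laplace transform of \<open>-tanh(t)/t\<close>.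
\<close>

lemma beta_nth_Suc: "fps_nth beta (Suc n) = - fact n * fps_nth tanh_fps (Suc n)"
proof (cases "even n")
  case False
  then show ?thesis by (simp add: beta_def tanh_fps_nth_even)
next
  case True
  then obtain j where n: "n = 2 * j" ..
  have beta: "fps_nth beta (Suc n)
      = 2 ^ (n + 2) * (1 - 2 ^ (n + 2)) * bernoulli (n + 2) / (of_nat (n + 2) * of_nat (n + 1))"
    by (simp add: beta_def n b_def genocchi_even_def)
  have "fps_nth tanh_fps (Suc n) = (2 ^ (n + 2) - 1) * 2 ^ (n + 2) * bernoulli (n + 2) / fact (n + 2)"
    using tanh_fps_nth_bernoulli [of "n + 2"] by simp
  also have "(fact (n + 2) :: rat) = of_nat (n + 2) * of_nat (n + 1) * fact n"
    by simp
  finally have th: "fps_nth tanh_fps (Suc n) = (2 ^ (n + 2) - 1) * 2 ^ (n + 2) * bernoulli (n + 2)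
      / (of_nat (n + 2) * of_nat (n + 1) * fact n)" .
  have aux: "f \<noteq> 0 \<Longrightarrow> P * (1 - P) * B / (c * d) = - f * ((P - 1) * P * B / (c * d * f))"
    for P B c d f :: rat
    by (simp add: divide_simps) (simp add: algebra_simps)
  show ?thesis
    unfolding beta th by (rule aux [OF fact_nonzero])
qed

text \<open>
  The right-hand side is \<open>-log (1 + 2Y)\<close>, the Laplace transform of \<open>(e\<^sup>-\<^sup>2\<^sup>t - 1)/t\<close>, which equals
  \<open>-(1 + e\<^sup>-\<^sup>2\<^sup>t) tanh(t)/t\<close>.
\<close>

lemma beta_functional_eq:
  "shift 2 beta + beta = Abs_fps (\<lambda>n. if n = 0 then 0 else (- 2) ^ n / of_nat n)"
proof -
  define h :: "rat fps" where "h = Abs_fps (\<lambda>n. - fps_nth tanh_fps (Suc n))"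
  have beta: "beta = laplace h"
  proof (rule fps_ext)
    show "fps_nth beta n = fps_nth (laplace h) n" for n
      by (cases n) (simp_all add: beta_nth_0 beta_nth_Suc h_def)
  qed
  have Xh: "fps_X * h = - tanh_fps"
    by (rule fps_ext) (simp add: h_def tanh_fps_nth_0 fps_mult_fps_X_commute split: nat.splits)
  have "fps_exp (- 2) * tanh_fps + tanh_fps = 1 - (fps_exp (- 2) :: rat fps)"
  proof -
    have "fps_exp (- 2) * fps_exp 2 = (1 :: rat fps)"
      using fps_exp_add_mult [of "- 2 :: rat" 2] by simp
    then show ?thesis
      using arg_cong [OF tanh_fps_mult, of "\<lambda>x. fps_exp (- 2) * (x :: rat fps)"]
      by (simp add: algebra_simps)
  qed
  moreover have "fps_X * (fps_exp (- 2) * h + h) = fps_exp (- 2) * (fps_X * h) + fps_X * h"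
    by (simp only: algebra_simps)
  then have "fps_X * (fps_exp (- 2) * h + h) = - (fps_exp (- 2) * tanh_fps + tanh_fps)"
    unfolding Xh by simp
  ultimately have "fps_X * (fps_exp (- 2) * h + h) = fps_exp (- 2) - 1"
    by simp
  then have "fps_nth (fps_X * (fps_exp (- 2) * h + h)) (Suc n) = fps_nth (fps_exp (- 2) - 1) (Suc n)" for n
    by (simp only:)
  then have "fps_nth (fps_exp (- 2) * h + h) n = (- 2) ^ Suc n / fact (Suc n)" for n
    by (simp del: power_Suc fact_Suc)
  moreover have "shift 2 beta + beta = laplace (fps_exp (- 2) * h + h)"
    by (simp add: beta laplace_add laplace_exp_mult)
  ultimately have "fps_nth (shift 2 beta + beta) (Suc n) = fact n * ((- 2) ^ Suc n / fact (Suc n))" for n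
    by (simp only: laplace_nth_Suc)
  moreover have "fact n * (x / fact (Suc n)) = x / of_nat (Suc n)" for n and x :: rat
    by (simp only: fact_Suc of_nat_mult) (simp add: divide_simps)
  ultimately have "fps_nth (shift 2 beta + beta) (Suc n) = (- 2) ^ Suc n / of_nat (Suc n)" for n
    by (simp only:)
  moreover have "fps_nth (shift 2 beta + beta) 0 = 0"
    by (simp add: beta_nth_0)
  ultimately have "fps_nth (shift 2 beta + beta) n = (if n = 0 then 0 else (- 2) ^ n / of_nat n)" for n
    by (cases n) (simp_all only: nat.distinct if_True if_False refl if_cancel)
  then show ?thesis
    by (intro fps_ext) (simp only: fps_nth_Abs_fps)
qed

lemma fps_linear_ODE_unique:
  fixes u v d :: "'a::field_char_0 fps"
  assumes "fps_deriv u = u * d" "fps_deriv v = v * d" "fps_nth u 0 = fps_nth v 0"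
  shows "u = v"
proof (rule fps_ext)
  fix n
  show "fps_nth u n = fps_nth v n"
  proof (induction n rule: less_induct)
    case (less n)
    show ?case
    proof (cases n)
      case 0
      then show ?thesis using assms(3) by simp
    next
      case (Suc k)
      have "fps_nth (fps_deriv u) k = fps_nth (fps_deriv v) k"
        unfolding assms(1,2) fps_mult_nth using less.IH Suc by (intro sum.cong) auto
      moreover have "of_nat (k + 1) \<noteq> (0 :: 'a)"
        by (simp only: of_nat_eq_0_iff)
      ultimately show ?thesis
        using Suc by (simp only: fps_deriv_nth) simp
    qed
  qed
qed

lemma fps_deriv_exp_compose:
  fixes f :: "'a::field_char_0 fps"
  assumes "fps_nth f 0 = 0"
  shows "fps_deriv (fps_exp 1 oo f) = (fps_exp 1 oo f) * fps_deriv f"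
  using assms by (simp add: fps_compose_deriv)

lemma fps_exp_compose_add:
  fixes f h :: "'a::field_char_0 fps"
  assumes "fps_nth f 0 = 0" "fps_nth h 0 = 0"
  shows "(fps_exp 1 oo (f + h)) = (fps_exp 1 oo f) * (fps_exp 1 oo h)"
proof (rule fps_linear_ODE_unique)
  show "fps_deriv (fps_exp 1 oo (f + h)) = (fps_exp 1 oo (f + h)) * fps_deriv (f + h)"
    using assms by (intro fps_deriv_exp_compose) simp
  show "fps_deriv ((fps_exp 1 oo f) * (fps_exp 1 oo h))
      = (fps_exp 1 oo f) * (fps_exp 1 oo h) * fps_deriv (f + h)"
    using assms by (simp only: fps_deriv_mult fps_deriv_exp_compose) (simp add: algebra_simps)
qed simp

definition exp_beta :: "rat fps" where
  "exp_beta = fps_exp 1 oo beta"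

text \<open>
  The exponential of the additive equation. That \<open>exp\<close> of the logarithmic series is \<open>1 / (1 + 2Y)\<close>
  follows since both solve the same linear differential equation.
\<close>

lemma exp_beta_functional_eq: "shift 2 exp_beta * exp_beta * lin (- 2) = 1"
proof -
  define N :: "rat fps" where "N = Abs_fps (\<lambda>n. if n = 0 then 0 else (- 2) ^ n / of_nat n)"
  define l where "l = lin (- 2 :: rat)"
  have "fps_deriv N = fps_const (- 2) * Abs_fps (\<lambda>n. (- 2) ^ n)"
    by (rule fps_ext) (simp add: N_def)
  also have "Abs_fps (\<lambda>n. (- 2) ^ n) = inverse l"
    using one_minus_const_fps_X_neg_power' [of 1 "- 2 :: rat"] by (simp add: l_def lin_def)
  finally have N': "fps_deriv N = fps_const (- 2) * inverse l" .
  have "inverse l = fps_exp 1 oo N"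
  proof (rule fps_linear_ODE_unique)
    show "fps_deriv (fps_exp 1 oo N) = (fps_exp 1 oo N) * fps_deriv N"
      by (rule fps_deriv_exp_compose) (simp add: N_def)
    have "fps_deriv l = fps_const 2"
      by (simp add: l_def lin_def)
    moreover have "fps_deriv (inverse l * l) = 0"
      by (simp add: l_def)
    ultimately have "fps_deriv (inverse l) * l = - (inverse l * fps_const 2)"
      by (metis fps_deriv_mult add.commute eq_neg_iff_add_eq_0)
    also have "\<dots> = inverse l * fps_const (- 2) * (inverse l * l)"
      by (simp add: l_def flip: fps_const_neg)
    also have "\<dots> = inverse l * fps_deriv N * l"
      unfolding N' by (simp only: mult_ac)
    finally have "fps_deriv (inverse l) * l = inverse l * fps_deriv N * l" .
    then show "fps_deriv (inverse l) = inverse l * fps_deriv N"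
      by (rule fps_mult_right_cancel_rule) (simp add: l_def)
  qed (simp add: l_def N_def)
  also have "N = shift 2 beta + beta"
    unfolding N_def beta_functional_eq ..
  also have "fps_exp 1 oo (shift 2 beta + beta) = (fps_exp 1 oo shift 2 beta) * exp_beta"
    by (simp add: fps_exp_compose_add exp_beta_def beta_nth_0)
  also have "fps_exp 1 oo shift 2 beta = shift 2 exp_beta"
    unfolding shift_def exp_beta_def by (rule fps_compose_assoc) (simp_all add: beta_nth_0)
  finally have "inverse l = shift 2 exp_beta * exp_beta" .
  then show ?thesis
    by (metis l_def lin_inverse(2))
qed

section \<open>Closed form of the ratio of moments\<close>

definition inv_square_linear :: "rat fps" where
  "inv_square_linear = inverse ((1 - fps_X)\<^sup>2 * (1 + fps_X))"

lemma FF_conv_shift: "FF = - 4 * fps_X\<^sup>2 * shift (- 1) exp_beta * inv_square_linear"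
proof -
  have "fps_exp 1 oo B_series = shift (- 1) exp_beta"
    unfolding B_series_def exp_beta_def shift_def beta_def [symmetric] lin_def
    by (subst fps_compose_assoc) (simp_all add: beta_nth_0)
  then show ?thesis
    by (simp add: FF_def inv_square_linear_def)
qed

lemma FF_nth:
  "fps_nth FF (2 * m + 2) = - 4 * fps_nth (shift (- 1) exp_beta * inv_square_linear) (2 * m)"
proof -
  have "FF = fps_X\<^sup>2 * (fps_const (- 4) * (shift (- 1) exp_beta * inv_square_linear))"
    by (simp add: FF_conv_shift numeral_fps_const mult_ac flip: fps_const_neg)
  then have "fps_nth FF (2 * m + 2)
      = fps_nth (fps_X\<^sup>2 * (fps_const (- 4) * (shift (- 1) exp_beta * inv_square_linear))) (2 * m + 2)"
    by (simp only:)
  then show ?thesis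
    unfolding fps_X_power_mult_nth by (simp del: fps_const_neg)
qed

definition of_rat_fps :: "rat fps \<Rightarrow> complex fps" where
  "of_rat_fps f = Abs_fps (\<lambda>n. of_rat (fps_nth f n))"

lemma of_rat_fps_nth [simp]: "fps_nth (of_rat_fps f) n = of_rat (fps_nth f n)"
  by (simp add: of_rat_fps_def)

lemma of_rat_fps_1 [simp]: "of_rat_fps 1 = 1"
  by (rule fps_ext) simp

lemma of_rat_fps_X [simp]: "of_rat_fps fps_X = fps_X"
  by (rule fps_ext) (simp add: fps_X_def)

lemma of_rat_fps_mult: "of_rat_fps (f * h) = of_rat_fps f * of_rat_fps h"
  by (rule fps_ext) (simp add: fps_mult_nth of_rat_sum of_rat_mult)

lemma of_rat_fps_power: "of_rat_fps (f ^ n) = of_rat_fps f ^ n"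
  by (induction n) (simp_all add: of_rat_fps_mult)

lemma of_rat_fps_lin: "of_rat_fps (lin c) = lin (of_rat c)"
  by (rule fps_ext) (simp add: lin_def of_rat_diff of_rat_mult fps_X_def)

lemma of_rat_fps_inverse_lin: "of_rat_fps (inverse (lin c)) = inverse (lin (of_rat c))"
proof -
  have "of_rat_fps (inverse (lin c)) * lin (of_rat c) = of_rat_fps (inverse (lin c) * lin c)"
    by (simp only: of_rat_fps_lin of_rat_fps_mult)
  also have "\<dots> = inverse (lin (of_rat c)) * lin (of_rat c)"
    by simp
  finally show ?thesis
    by (rule fps_mult_right_cancel_rule) simp
qed

lemma of_rat_fps_shift: "of_rat_fps (shift a f) = shift (of_rat a) (of_rat_fps f)"
proof (rule fps_ext)
  fix n
  have "of_rat_fps ((fps_X * inverse (lin (- a))) ^ i) = (fps_X * inverse (lin (- of_rat a))) ^ i" for i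
    by (simp add: of_rat_fps_power of_rat_fps_mult of_rat_fps_inverse_lin of_rat_minus)
  from arg_cong [OF this, of "\<lambda>f. fps_nth f n"]
  have "(of_rat (fps_nth ((fps_X * inverse (lin (- a))) ^ i) n) :: complex)
      = fps_nth ((fps_X * inverse (lin (- of_rat a))) ^ i) n" for i
    unfolding of_rat_fps_nth .
  then show "fps_nth (of_rat_fps (shift a f)) n = fps_nth (shift (of_rat a) (of_rat_fps f)) n"
    by (simp add: shift_nth of_rat_sum of_rat_mult)
qed

text \<open>
  Both sides satisfy \<open>Q(Z+2) Q(Z) = (Z-1)/(Z+1)\<close>, and the solution with constant term \<open>1\<close> is
  unique. On the left this is the recurrence of \<open>F\<^sub>0\<close> over a shift by \<open>4\<close>; on the right it is the functional
  equation of \<open>exp_beta\<close> in the variable \<open>Z - 1\<close>.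
\<close>

lemma moment_ratio_conv_exp_beta:
  "lin 1 * moment_ratio = of_rat_fps (shift (- 1) exp_beta)" (is "?Q = of_rat_fps ?e")
proof (rule shift_mult_self_unique)
  let ?m = "moment 0 0" and ?i = "\<lambda>k. inverse (lin k) :: complex fps"
  define m2 m4 where "m2 = shift 2 ?m" and "m4 = shift 4 ?m"
  have inv: "m2 * inverse m2 = 1" "m4 * inverse m4 = 1"
    by (simp_all add: inverse_mult_eq_1' moment_0_nth_0 m2_def m4_def)
  show "fps_nth ?Q 0 = 1"
    by (simp add: moment_ratio_def moment_0_nth_0)
  show "fps_nth (of_rat_fps ?e) 0 = 1"
    by (simp add: exp_beta_def)
  have "shift 4 ((lin 3)\<^sup>2 * shift (- 4) ?m) = shift 4 (lin 4 * lin 2 * ?m)"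
    by (simp only: moment_0_recurrence)
  then have "(lin (- 1) * ?i (- 4))\<^sup>2 * ?m = ?i (- 4) * (lin (- 2) * ?i (- 4)) * m4"
    by (simp add: shift_mult shift_power shift_lin shift_shift m4_def)
  then have "((lin (- 1))\<^sup>2 * ?m) * (?i (- 4) * ?i (- 4)) = (lin (- 2) * m4) * (?i (- 4) * ?i (- 4))"
    by (simp only: power2_eq_square mult_ac)
  moreover have "?i (- 4) \<noteq> 0"
    using lin_inverse(1) [of "- 4 :: complex"] by force
  ultimately have m4: "(lin (- 1))\<^sup>2 * ?m = lin (- 2) * m4"
    by simp
  have "shift 2 ?Q * ?Q = (lin (- 1) * ?i (- 2)) * (m2 * inverse m4) * (lin 1 * (?m * inverse m2))"
    by (simp add: moment_ratio_def shift_mult shift_lin shift_inverse shift_shift moment_0_nth_0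
        m2_def m4_def)
  also have "\<dots> = (m2 * inverse m2) * (lin 1 * ?i (- 1) * ?i (- 2) * inverse m4 * ((lin (- 1))\<^sup>2 * ?m))"
    by (simp add: power2_eq_square mult_ac)
  also have "\<dots> = lin 1 * ?i (- 1) * (?i (- 2) * (lin (- 2) * (m4 * inverse m4)))"
    unfolding m4 inv(1) by (simp only: mult_1_left mult_ac)
  finally have Q: "shift 2 ?Q * ?Q = lin 1 * ?i (- 1)"
    by (simp only: inv lin_inverse mult_1_right)
  have "shift (- 1) (shift 2 exp_beta * exp_beta * lin (- 2)) = 1"
    by (simp only: exp_beta_functional_eq shift_1)
  then have "shift 2 ?e * ?e * (lin (- 1) * inverse (lin 1)) = 1"
    by (simp add: shift_mult shift_lin shift_shift)
  then have "of_rat_fps (shift 2 ?e * ?e * (lin (- 1) * inverse (lin 1))) = 1"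
    by simp
  then have "shift 2 (of_rat_fps ?e) * of_rat_fps ?e * (lin (- 1) * ?i 1) = 1"
    by (simp add: of_rat_fps_mult of_rat_fps_shift [of 2] of_rat_fps_lin of_rat_fps_inverse_lin of_rat_minus)
  then have "shift 2 (of_rat_fps ?e) * of_rat_fps ?e * (lin (- 1) * ?i 1) * (lin 1 * ?i (- 1)) = lin 1 * ?i (- 1)"
    by simp
  then show "shift 2 ?Q * ?Q = shift 2 (of_rat_fps ?e) * of_rat_fps ?e"
    unfolding Q by (simp add: mult_ac)
qed

lemma W_nth_rational:
  "fps_nth W (2 * m) = of_rat (- fps_nth FF (2 * m + 2) / (4 * fact (2 * m + 1)))"
proof -
  have factor: "inv_square_linear = inverse (lin (- 1)) * (inverse (lin 1) * inverse (lin 1))"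
    by (simp add: inv_square_linear_def lin_def power2_eq_square fps_inverse_mult mult_ac flip: fps_const_neg)
  have "of_rat_fps (shift (- 1) exp_beta * inv_square_linear)
      = lin 1 * moment_ratio * (inverse (lin (- 1)) * (inverse (lin 1) * inverse (lin 1)))"
    by (simp add: of_rat_fps_mult factor of_rat_fps_inverse_lin of_rat_minus moment_ratio_conv_exp_beta)
  also have "\<dots> = inverse (lin (- 1)) * inverse (lin 1) * moment_ratio"
    by (simp add: mult_ac)
  finally have "fps_X\<^sup>2 * of_rat_fps (shift (- 1) exp_beta * inv_square_linear)
      = fps_X\<^sup>2 * inverse (lin (- 1)) * inverse (lin 1) * moment_ratio"
    by (simp only: mult.assoc)
  then have "fps_nth W (2 * m)
      = fps_nth (fps_X\<^sup>2 * of_rat_fps (shift (- 1) exp_beta * inv_square_linear)) (2 * m + 2) / fact (2 * m + 1)"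
    by (simp only: W_nth)
  also have "\<dots> = of_rat (fps_nth (shift (- 1) exp_beta * inv_square_linear) (2 * m) / fact (2 * m + 1))"
    unfolding fps_X_power_mult_nth using of_rat_of_nat_eq [of "fact (2 * m + 1)", where 'a = complex]
    by (simp add: of_rat_divide del: fact_Suc)
  finally show ?thesis
    unfolding FF_nth by (simp del: fact_Suc)
qed

section \<open>Odd integers in the exponential series\<close>

definition tangent :: "nat \<Rightarrow> rat" where
  "tangent n = fact n * fps_nth tanh_fps n"

lemma tangent_0: "tangent 0 = 0"
  by (simp add: tangent_def tanh_fps_nth_0)

lemma fact_mult_fps_nth:
  fixes f h :: "'a::field_char_0 fps"
  shows "fact n * fps_nth (f * h) n
    = (\<Sum>k\<le>n. of_nat (n choose k) * (fact k * fps_nth f k) * (fact (n - k) * fps_nth h (n - k)))"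
  unfolding fps_mult_nth sum_distrib_left atLeast0AtMost
  by (rule sum.cong) (simp_all add: binomial_fact)

lemma tangent_Suc:
  "tangent (Suc n) = of_bool (n = 0) - (\<Sum>k\<le>n. of_nat (n choose k) * tangent k * tangent (n - k))"
proof -
  have "tangent (Suc n) = fact n * fps_nth (fps_deriv tanh_fps) n"
    by (simp add: tangent_def)
  also have "\<dots> = of_bool (n = 0) - fact n * fps_nth (tanh_fps * tanh_fps) n"
    by (simp add: tanh_fps_deriv algebra_simps power2_eq_square)
  finally show ?thesis
    unfolding fact_mult_fps_nth tangent_def .
qed

text \<open>
  The equation \<open>tanh'' = -2 tanh tanh'\<close> makes the parity of the tangent numbers visible.
\<close>

lemma tangent_Suc_Suc:
  "tangent (Suc (Suc n)) = - 2 * (\<Sum>k\<le>n. of_nat (n choose k) * tangent k * tangent (Suc (n - k)))"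
proof -
  let ?t = "tanh_fps :: rat fps"
  have "fps_deriv (fps_deriv ?t) = fps_deriv (1 - ?t * ?t)"
    by (simp only: tanh_fps_deriv power2_eq_square)
  also have "\<dots> = - (?t * fps_deriv ?t + ?t * fps_deriv ?t)"
    by (simp only: fps_deriv_sub fps_deriv_mult fps_deriv_1 mult.commute [of "fps_deriv ?t"]) simp
  finally have *: "fps_deriv (fps_deriv ?t) = - (?t * fps_deriv ?t + ?t * fps_deriv ?t)" .
  have "tangent (Suc (Suc n)) = fact n * fps_nth (fps_deriv (fps_deriv ?t)) n"
    by (simp add: tangent_def)
  also have "\<dots> = - 2 * (fact n * fps_nth (?t * fps_deriv ?t) n)"
    unfolding * by simp
  also have "fact n * fps_nth (?t * fps_deriv ?t) n
      = (\<Sum>k\<le>n. of_nat (n choose k) * tangent k * tangent (Suc (n - k)))"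
    unfolding fact_mult_fps_nth by (intro sum.cong refl) (simp add: tangent_def)
  finally show ?thesis .
qed

lemma tangent_Ints: "tangent n \<in> \<int>"
proof (induction n rule: less_induct)
  case (less n)
  show ?case
  proof (cases n)
    case 0
    then show ?thesis by (simp add: tangent_0)
  next
    case (Suc k)
    show ?thesis
      unfolding Suc tangent_Suc using less.IH Suc
      by (intro Ints_diff Ints_sum Ints_mult) (auto simp: of_bool_def)
  qed
qed

definition even_Ints :: "rat set" where
  "even_Ints = (\<lambda>x. 2 * x) ` \<int>"

lemma even_IntsI: "x \<in> \<int> \<Longrightarrow> 2 * x \<in> even_Ints"
  by (auto simp: even_Ints_def)

lemma even_Ints_0: "0 \<in> even_Ints"
  using even_IntsI [of 0] by simp

lemma even_IntsE:
  assumes "x \<in> even_Ints"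
  obtains y where "y \<in> \<int>" "x = 2 * y"
  using assms by (auto simp: even_Ints_def)

lemma even_Ints_imp_Ints: "x \<in> even_Ints \<Longrightarrow> x \<in> \<int>"
  by (auto elim: even_IntsE)

lemma even_Ints_mult: "x \<in> even_Ints \<Longrightarrow> y \<in> \<int> \<Longrightarrow> x * y \<in> even_Ints"
  by (elim even_IntsE) (simp add: mult.assoc even_IntsI)

lemma even_Ints_add:
  assumes "x \<in> even_Ints" "y \<in> even_Ints"
  shows "x + y \<in> even_Ints"
proof -
  obtain x' y' where "x' \<in> \<int>" "y' \<in> \<int>" "x = 2 * x'" "y = 2 * y'"
    using assms by (meson even_IntsE)
  then show ?thesis
    using even_IntsI [of "x' + y'"] by (simp add: distrib_left)
qed

lemma even_Ints_uminus: "x \<in> even_Ints \<Longrightarrow> - x \<in> even_Ints"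
  using even_Ints_mult [of x "- 1"] by simp

lemma even_Ints_sum: "(\<And>k. k \<in> K \<Longrightarrow> f k \<in> even_Ints) \<Longrightarrow> sum f K \<in> even_Ints"
  by (induction K rule: infinite_finite_induct) (auto intro: even_Ints_0 even_Ints_add)

lemma even_Ints_of_nat: "even n \<Longrightarrow> of_nat n \<in> even_Ints"
  by (elim evenE) (simp add: even_IntsI)

lemma tangent_even: "n \<noteq> 1 \<Longrightarrow> tangent n \<in> even_Ints"
proof -
  consider "n = 0" | "n = 1" | k where "n = Suc (Suc k)"
    by (metis One_nat_def not0_implies_Suc)
  then show "n \<noteq> 1 \<Longrightarrow> tangent n \<in> even_Ints"
  proof cases
    case 3
    have "(\<Sum>j\<le>k. of_nat (k choose j) * tangent j * tangent (Suc (k - j))) \<in> \<int>"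
      by (intro Ints_sum Ints_mult tangent_Ints) auto
    then show ?thesis
      unfolding 3 tangent_Suc_Suc using even_Ints_uminus [OF even_IntsI] by simp
  qed (simp_all add: tangent_0 even_Ints_0)
qed

lemma tangent_1: "tangent 1 = 1"
  using tangent_Suc [of 0] by (simp add: tangent_0)

text \<open>
  Write \<open>\<epsilon>\<^sub>n = n! e\<^sub>n\<close>. The equation \<open>E' = E \<beta>'\<close> with \<open>\<beta>' = -\<Sum> T\<^sub>n\<^sub>+\<^sub>1 Y\<^sup>n\<close> reads
  \<open>\<epsilon>\<^sub>m\<^sub>+\<^sub>1 = -\<epsilon>\<^sub>m + (even)\<close>, as \<open>T\<^sub>1 = 1\<close> and all other tangent numbers are even. So every \<open>\<epsilon>\<^sub>n\<close> has the
  parity of \<open>\<epsilon>\<^sub>0 = 1\<close>.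
\<close>

lemma exp_beta_coefficient_odd: "fact n * fps_nth exp_beta n - 1 \<in> even_Ints"
proof (induction n rule: less_induct)
  case (less n)
  show ?case
  proof (cases n)
    case 0
    then show ?thesis by (simp add: exp_beta_def even_Ints_0)
  next
    case (Suc m)
    define e where "e k = fact k * fps_nth exp_beta k" for k
    have "fact n * fps_nth exp_beta n = fact m * fps_nth (fps_deriv exp_beta) m"
      by (simp add: Suc)
    also have "fps_deriv exp_beta = exp_beta * fps_deriv beta"
      unfolding exp_beta_def by (rule fps_deriv_exp_compose) (rule beta_nth_0)
    also have "fact m * fps_nth \<dots> m = (\<Sum>k\<le>m. of_nat (m choose k) * e k
        * (fact (m - k) * (- tangent (Suc (m - k)))))"
      unfolding fact_mult_fps_nth e_def
      by (intro sum.cong refl) (simp add: beta_nth_Suc tangent_def)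
    \<comment> \<open>The summand \<open>k = m\<close> is the one with the odd tangent number \<open>T\<^sub>1 = 1\<close>.\<close>
    also have "\<dots> = - e m + (\<Sum>k<m. of_nat (m choose k) * e k
        * (fact (m - k) * (- tangent (Suc (m - k)))))"
      by (simp add: lessThan_Suc_atMost [symmetric] tangent_1 [simplified])
    finally have *: "fact n * fps_nth exp_beta n - 1 = (- 2 + - (e m - 1)) + (\<Sum>k<m. - tangent (Suc (m - k))
        * (of_nat (m choose k) * (e k * fact (m - k))))"
      by (simp add: mult_ac)
    have "e k - 1 \<in> even_Ints" if "k < n" for k
      using less.IH [OF that] by (simp add: e_def)
    moreover from this have "e k \<in> \<int>" if "k < n" for k
      using that by (metis (no_types, lifting) Ints_1 Ints_add Ints_mult Ints_numeral diff_add_cancel even_Ints_def image_iff)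
    moreover have "2 \<in> even_Ints"
      using even_IntsI [of 1] by simp
    ultimately show ?thesis
      unfolding * using Suc
      by (intro even_Ints_add even_Ints_uminus even_Ints_sum even_Ints_mult tangent_even Ints_mult fact_in_Ints) auto
  qed
qed

section \<open>The coefficients and their 2-adic valuation\<close>

definition integral_fps :: "rat fps \<Rightarrow> bool" where
  "integral_fps f \<longleftrightarrow> (\<forall>n. fps_nth f n \<in> \<int>)"

lemma integral_fps_mult: "integral_fps f \<Longrightarrow> integral_fps h \<Longrightarrow> integral_fps (f * h)"
  by (auto simp: integral_fps_def fps_mult_nth intro!: Ints_sum Ints_mult)

lemma integral_fps_power: "integral_fps f \<Longrightarrow> integral_fps (f ^ n)"
  by (induction n) (auto simp: integral_fps_mult, auto simp: integral_fps_def)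

lemma integral_fps_X: "integral_fps fps_X"
  by (auto simp: integral_fps_def fps_X_def)

lemma integral_fps_inverse_lin: "c \<in> \<int> \<Longrightarrow> integral_fps (inverse (lin c))"
  using one_minus_const_fps_X_neg_power' [of 1 c]
  by (simp add: integral_fps_def lin_def)

lemma integral_fps_inv_square_linear: "integral_fps inv_square_linear"
proof -
  have eq: "inv_square_linear = inverse (lin 1) ^ 2 * inverse (lin (- 1))"
    by (simp add: inv_square_linear_def lin_def fps_inverse_mult fps_inverse_power flip: fps_const_neg)
  show ?thesis
    unfolding eq by (intro integral_fps_mult integral_fps_power integral_fps_inverse_lin) auto
qed

text \<open>
  The coefficient is the double sum of \<open>e\<^sub>n [X\<^sup>j](X/(1-X))\<^sup>n [X\<^sup>2\<^sup>m\<^sup>-\<^sup>j] 1/((1-X)\<^sup>2(1+X))\<close> over \<open>n \<le> j \<le> 2m\<close>.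
  Multiplied by \<open>(2m)!\<close>, a term with \<open>n < 2m\<close> contains the even factor \<open>(2m)!/n!\<close>; the remaining
  term is \<open>(2m)! e\<^sub>2\<^sub>m\<close>.
\<close>

lemma FF_coefficient_odd:
  "fact (2 * m) * fps_nth (shift (- 1) exp_beta * inv_square_linear) (2 * m) - 1 \<in> even_Ints"
proof -
  define M where "M = 2 * m"
  define s where "s = fps_X * inverse (lin (1 :: rat))"
  define e where "e n = fact n * fps_nth exp_beta n" for n
  define c where "c n j = fps_nth (s ^ n) j * fps_nth inv_square_linear (M - j)" for n j
  have "integral_fps s"
    unfolding s_def by (intro integral_fps_mult integral_fps_X integral_fps_inverse_lin) simp
  then have c_Ints: "c n j \<in> \<int>" for n j
    using integral_fps_power [of s n] integral_fps_inv_square_linear by (auto simp: c_def integral_fps_def)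
  have e_even: "e n - 1 \<in> even_Ints" for n
    unfolding e_def by (rule exp_beta_coefficient_odd)
  then have e_Ints: "e n \<in> \<int>" for n
    using Ints_add [OF even_Ints_imp_Ints [OF e_even [of n]] Ints_1] by simp
  have "fact M * fps_nth (shift (- 1) exp_beta * inv_square_linear) M
      = (\<Sum>j\<le>M. \<Sum>n\<le>j. fact M * (fps_nth exp_beta n * c n j))"
    by (simp only: fps_mult_nth shift_def fps_compose_nth s_def c_def sum_distrib_left
        sum_distrib_right atLeast0AtMost mult.assoc minus_minus)
  also have "\<dots> = (\<Sum>j\<le>M. \<Sum>n\<le>j. (fact M / fact n) * (e n * c n j))"
    by (intro sum.cong refl) (simp add: e_def)
  also have "\<dots> = (\<Sum>j<M. \<Sum>n\<le>j. (fact M / fact n) * (e n * c n j))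
      + (\<Sum>n<M. (fact M / fact n) * (e n * c n M)) + e M * c M M"
    by (simp add: lessThan_Suc_atMost [symmetric])
  also have "c M M = 1"
    by (simp add: c_def s_def fps_X_mult_unit_power_nth inv_square_linear_def fps_power_zeroth)
  finally have *: "fact M * fps_nth (shift (- 1) exp_beta * inv_square_linear) M - 1
      = (\<Sum>j<M. \<Sum>n\<le>j. (fact M / fact n) * (e n * c n j))
      + (\<Sum>n<M. (fact M / fact n) * (e n * c n M)) + (e M - 1)"
    by simp
  have "fact M / fact n \<in> even_Ints" if less: "n < M" for n
  proof -
    obtain M' where M': "M = Suc M'"
      using less by (cases M) auto
    have "fact n dvd (fact M' :: int)"
      using less M' by (intro fact_dvd) simp
    then obtain q :: int where "fact M' = fact n * q" ..
    then have "(fact M' :: rat) = fact n * of_int q"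
      by (metis of_int_fact of_int_mult)
    then have "fact M / fact n = of_nat M * (of_int q :: rat)"
      by (simp add: M')
    then show ?thesis
      using even_Ints_mult [OF even_Ints_of_nat, of M "of_int q"] by (simp add: M_def)
  qed
  then show ?thesis
    unfolding M_def [symmetric] *
    by (intro even_Ints_add even_Ints_sum even_Ints_mult Ints_mult e_even e_Ints c_Ints) auto
qed

lemma nu2_of_int_divide:
  assumes "p \<noteq> 0" "q \<noteq> 0"
  shows "nu2 (of_int p / of_int q) = int (multiplicity 2 p) - int (multiplicity 2 q)"
proof -
  \<comment> \<open>Cross-multiplication with the reduced fraction reduces the claim to additivity on the integers.\<close>
  obtain r s where rs: "quotient_of (of_int p / of_int q) = (r, s)"
    by fastforce
  have "s > 0"
    using quotient_of_denom_pos [OF rs] .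
  have "of_int p / of_int q = (of_int r / of_int s :: rat)"
    using quotient_of_div [OF rs] .
  then have "of_int (p * s) = (of_int (r * q) :: rat)"
    using assms \<open>s > 0\<close> by (simp add: field_simps)
  then have eq: "p * s = r * q"
    by (simp only: of_int_eq_iff)
  then have "r \<noteq> 0"
    using assms \<open>s > 0\<close> by auto
  have "prime_elem (2 :: int)"
    by simp
  then have "multiplicity 2 p + multiplicity 2 s = multiplicity 2 r + multiplicity 2 q"
    using eq \<open>r \<noteq> 0\<close> \<open>s > 0\<close> assms
    by (metis less_irrefl prime_elem_multiplicity_mult_distrib)
  then show ?thesis
    by (simp add: nu2_def rs)
qed

lemma odd_IntsE:
  assumes "x - 1 \<in> even_Ints"
  obtains k where "odd k" "x = of_int k"
proof -
  obtain y where "y \<in> \<int>" "x - 1 = 2 * y"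
    using assms by (rule even_IntsE)
  then obtain j where "x - 1 = 2 * of_int j"
    by (auto elim: Ints_cases)
  then have "x = of_int (2 * j + 1)"
    by simp
  then show thesis
    using that [of "2 * j + 1"] by simp
qed

lemma FF_coefficient_valuation:
  fixes x :: rat
  assumes x: "x = - fps_nth FF (2 * m + 2) / (4 * fact (2 * m + 1))"
  shows "x \<noteq> 0" "nu2 x = - 2 * nu2 (fact (2 * m))" "(fact (2 * m))\<^sup>2 * x \<in> two_adic_units"
proof -
  obtain k where k: "odd k"
    and "fact (2 * m) * fps_nth (shift (- 1) exp_beta * inv_square_linear) (2 * m) = of_int k"
    using FF_coefficient_odd by (rule odd_IntsE)
  then have c: "fps_nth (shift (- 1) exp_beta * inv_square_linear) (2 * m) = of_int k / fact (2 * m)"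
    by (simp add: field_simps)
  define d where "d = 2 * int m + 1"
  define M where "M = (fact (2 * m) :: int)"
  have d: "odd d" "d \<noteq> 0" and M: "M \<noteq> 0" and k0: "k \<noteq> 0"
    using k by (auto simp: d_def M_def)
  have of_M: "fact (2 * m) = (of_int M :: rat)"
    by (simp add: M_def)
  have of_d: "fact (2 * m + 1) = (of_int d * of_int M :: rat)"
    by (simp add: M_def d_def)
  have "x = of_int k / fact (2 * m) / fact (2 * m + 1)"
    unfolding x FF_nth c by simp
  then have x': "x = of_int k / of_int (M * M * d)"
    unfolding of_d of_M by (simp add: mult_ac)
  then show "x \<noteq> 0"
    using k0 d M by simp
  have [simp]: "multiplicity 2 k = 0" "multiplicity 2 d = 0"
    using k d by (simp_all add: not_dvd_imp_multiplicity_0)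
  have "multiplicity 2 (M * M * d) = 2 * multiplicity 2 M"
    using d M by (simp add: prime_elem_multiplicity_mult_distrib)
  then have "nu2 x = - 2 * int (multiplicity 2 M)"
    unfolding x' using k0 d M by (subst nu2_of_int_divide) auto
  moreover have "nu2 (of_int M) = int (multiplicity 2 M)"
    using nu2_of_int_divide [of M 1] M by simp
  ultimately show "nu2 x = - 2 * nu2 (fact (2 * m))"
    by (simp add: of_M)
  have "(fact (2 * m))\<^sup>2 * x = of_int k / of_int d"
    unfolding x' of_M using M d by (simp add: power2_eq_square field_simps)
  then show "(fact (2 * m))\<^sup>2 * x \<in> two_adic_units"
    using nu2_of_int_divide [of k d] k0 d by (simp add: two_adic_units_def)
qed

theorem theorem7p42:
  fixes m :: nat
  shows "fps_nth W (2 * m) = of_rat (w m)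
    \<and> w m = - fps_nth FF (2 * m + 2) / (4 * fact (2 * m + 1))
    \<and> w m \<noteq> 0 \<and> nu2 (w m) = - 2 * nu2 (fact (2 * m))
    \<and> (fact (2 * m))\<^sup>2 * w m \<in> two_adic_units"
proof -
  have w: "w m = - fps_nth FF (2 * m + 2) / (4 * fact (2 * m + 1))"
    unfolding w_def W_nth_rational by (rule the_equality) (simp_all only: of_rat_eq_iff)
  then show ?thesis
    using W_nth_rational [of m] FF_coefficient_valuation [OF w] by simp
qed

end
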